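(* Let $A$ be the 83-digit integer $$A=19613577555635811210751525911492599150619172808998516420233576073634048313995204010$$ and let $B$ be the 82-digit integer $$B=7609973832199104332900520118697392466473343921195005927808542086911702037440072483.$$ The arithmetic progression $Am+B$, where $m$ ranges over the nonnegative integers, contains infinitely many primes that are Brier numbers.
   Context: A Sierpiński number is a positive odd integer $k$ such that $k\cdot 2^n+1$ is composite for all nonnegative integers $n$. A Riesel number is a positive odd integer $k$ such that $k\cdot 2^n-1$ is composite for all nonnegative integers $n$. A Brier number is an integer that is both a Sierpiński number and a Riesel number. *)

theory Defs
  imports "HOL-Computational_Algebra.Primes"
begin

text \<open>Units, zero and negative integers are not composite.\<close>

definition composite :: "int \<Rightarrow> bool" where
  "composite n \<longleftrightarrow> n > 1 \<and> \<not> prime n"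

definition sierpinski_number :: "int \<Rightarrow> bool" where
  "sierpinski_number k \<longleftrightarrow> k > 0 \<and> odd k \<and> (\<forall>n::nat. composite (k * 2 ^ n + 1))"

definition riesel_number :: "int \<Rightarrow> bool" where
  "riesel_number k \<longleftrightarrow> k > 0 \<and> odd k \<and> (\<forall>n::nat. composite (k * 2 ^ n - 1))"

definition brier_number :: "int \<Rightarrow> bool" where
  "brier_number k \<longleftrightarrow> sierpinski_number k \<and> riesel_number k"

end

theory Submission
  imports Defs "HOL-Number_Theory.Number_Theory" "HOL-Computational_Algebra.Squarefree"
begin

text \<open>
  Each entry \<open>(l, r, d)\<close> of the two covering systems below satisfies \<open>d dvd A\<close>, \<open>d dvd 2 ^ l - 1\<close> and
  \<open>d dvd B * 2 ^ r \<plusminus> 1\<close>, so \<open>d\<close> divides \<open>k * 2 ^ n \<plusminus> 1\<close> whenever \<open>n\<close> is congruent to \<open>r\<close> modulo \<open>l\<close> and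
  \<open>k\<close> to \<open>B\<close> modulo \<open>A\<close>. Hence the whole progression consists of Brier numbers, and the rest is
  Dirichlet's theorem for the coprime pair \<open>A\<close>, \<open>B\<close>.

  Dirichlet's theorem is obtained in Mertens' form, by Shapiro's method: if \<open>\<chi>\<close> is a nonprincipal character
  modulo \<open>q\<close>, then \<open>\<Sum>n\<le>N. \<chi> n * \<Lambda> n / n\<close> is bounded if \<open>L(1,\<chi>) \<noteq> 0\<close>, and it is \<open>- ln N + O(1)\<close> if
  \<open>L(1,\<chi>) = 0\<close>. The latter is impossible: for nonreal \<open>\<chi>\<close> by the inequality \<open>3 + 4 cos t + cos 2t \<ge> 0\<close>,
  and for real \<open>\<chi>\<close> by Monsky's argument with Lambert series. Instead of the dual group, the passage from
  characters to residue classes uses that the functions on the units modulo \<open>q\<close> are sums of joint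
  eigenfunctions of the commuting operators \<open>f \<mapsto> f (g * _)\<close> of finite order, and such an eigenfunction is a
  multiple of a character.
\<close>

section \<open>Estimates of Chebyshev and Mertens\<close>

text \<open>The substitution n = d * m turns divisor sums into sums over pairs. \<open>F\<close>
  receives the divisor and the cofactor, so that one rule handles both Dirichlet convolutions and
  Lambert series.\<close>

lemma sum_divisors_swap:
  fixes F :: "nat \<Rightarrow> nat \<Rightarrow> 'a::comm_monoid_add"
  shows "(\<Sum>n=1..N. \<Sum>d | d dvd n. F d (n div d)) = (\<Sum>d=1..N. \<Sum>m=1..N div d. F d m)"
proof -
  have "(\<Sum>n=1..N. \<Sum>d | d dvd n. F d (n div d))
      = (\<Sum>(n,d)\<in>(SIGMA n:{1..N}. {d. d dvd n}). F d (n div d))"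
    by (subst sum.Sigma) auto
  also have "\<dots> = (\<Sum>(d,m)\<in>(SIGMA d:{1..N}. {1..N div d}). F d m)"
    by (rule sum.reindex_bij_witness[of _ "\<lambda>(d,m). (d*m,d)" "\<lambda>(n,d). (d, n div d)"])
      (auto simp: less_eq_div_iff_mult_less_eq Suc_le_eq mult.commute div_le_mono intro: dvd_pos_nat order_trans[OF dvd_imp_le])
  also have "\<dots> = (\<Sum>d=1..N. \<Sum>m=1..N div d. F d m)"
    by (subst sum.Sigma) auto
  finally show ?thesis .
qed

lemma ln_fact_ge: "real n * ln n - n \<le> ln (fact n)"
proof (induction n)
  case (Suc n)
  show ?case
  proof (cases "n = 0")
    case False
    have "ln (real n + 1) - ln n = ln ((real n + 1) / n)"
      using False by (subst ln_div) auto
    also have "(real n + 1) / n = 1 + 1 / n"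
      using False by (simp add: field_simps)
    also have "ln (1 + 1 / n) \<le> 1 / n"
      using False by (intro ln_add_one_self_le_self) simp
    finally have "real n * (ln (real n + 1) - ln n) \<le> 1"
      using False by (simp add: field_simps)
    moreover have "ln (fact (Suc n)) = ln (real n + 1) + ln (fact n)"
      using ln_mult[of "real n + 1" "fact n"] by (simp add: add.commute)
    ultimately show ?thesis
      using Suc by (simp add: algebra_simps)
  qed simp
qed simp

lemma ln_fact_le: "ln (fact n) \<le> real n * ln n"
proof (cases "n = 0")
  case False
  have "ln (fact n) \<le> ln (real n ^ n)"
    using False fact_le_power[of n, where 'a = real]
    by (subst ln_le_cancel_iff) auto
  thus ?thesis using False by (simp add: ln_realpow)
qed simp

lemma ln_fact_conv_sum: "ln (fact n) = (\<Sum>k=1..n. ln (real k))"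
  unfolding fact_prod of_nat_prod by (rule ln_prod) auto

abbreviation Lambda :: "nat \<Rightarrow> real" ("\<Lambda>") where "Lambda \<equiv> mangoldt"

lemma ln_fact_conv_mangoldt: "ln (fact N) = (\<Sum>d=1..N. \<Lambda> d * (N div d))"
proof -
  have "ln (fact N) = (\<Sum>n=1..N. \<Sum>d | d dvd n. \<Lambda> d)"
    unfolding ln_fact_conv_sum by (intro sum.cong) (auto simp: mangoldt_sum)
  also have "\<dots> = (\<Sum>d=1..N. \<Sum>m=1..N div d. \<Lambda> d)"
    by (rule sum_divisors_swap)
  finally show ?thesis by (simp add: mult.commute)
qed

text \<open>Chebyshev's argument: the logarithm of the central binomial coefficient is the sum of
  \<open>\<Lambda> d\<close> with weights \<open>2 * n div d - 2 * (n div d)\<close>. These are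
  nonnegative, and at least 1 for n < d \<le> 2 * n, while the coefficient is at most 4 ^ n.\<close>

lemma psi_double: "(\<Sum>d=1..2*n. \<Lambda> d) - (\<Sum>d=1..n. \<Lambda> d) \<le> 2 * real n * ln 2"
proof -
  have "(\<Sum>d=1..2*n. \<Lambda> d) - (\<Sum>d=1..n. \<Lambda> d) = (\<Sum>d\<in>{1..2*n}-{1..n}. \<Lambda> d)"
    by (subst sum_diff) auto
  also have "\<dots> \<le> (\<Sum>d\<in>{1..2*n}-{1..n}. \<Lambda> d * (real (2 * n div d) - 2 * real (n div d)))"
  proof (intro sum_mono)
    fix d assume d: "d \<in> {1..2*n} - {1..n}"
    hence "2 * n div d \<ge> 1" "n div d = 0" by (auto simp: less_eq_div_iff_mult_less_eq)
    hence "1 \<le> real (2 * n div d) - 2 * real (n div d)" by simp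
    thus "\<Lambda> d \<le> \<Lambda> d * (real (2 * n div d) - 2 * real (n div d))"
      using mult_left_mono[of 1 _ "\<Lambda> d"] mangoldt_nonneg[of d] by simp
  qed
  also have "\<dots> \<le> (\<Sum>d=1..2*n. \<Lambda> d * (real (2 * n div d) - 2 * real (n div d)))"
  proof (intro sum_mono2)
    fix d
    have "2 * (n div d) \<le> 2 * n div d" by (cases "d = 0") (auto simp: less_eq_div_iff_mult_less_eq)
    hence "0 \<le> real (2 * n div d) - 2 * real (n div d)" by linarith
    thus "0 \<le> \<Lambda> d * (real (2 * n div d) - 2 * real (n div d))"
      using mangoldt_nonneg[of d] by simp
  qed auto
  also have "\<dots> = (\<Sum>d=1..2*n. \<Lambda> d * (2 * n div d)) - 2 * (\<Sum>d=1..2*n. \<Lambda> d * (n div d))"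
    by (simp add: algebra_simps sum_subtractf sum_distrib_left)
  also have "(\<Sum>d=1..2*n. \<Lambda> d * (n div d)) = (\<Sum>d=1..n. \<Lambda> d * (n div d))"
    by (intro sum.mono_neutral_right) auto
  also have "(\<Sum>d=1..2*n. \<Lambda> d * (2 * n div d)) - 2 * \<dots> = ln (fact (2*n)) - 2 * ln (fact n)"
    by (simp only: ln_fact_conv_mangoldt)
  also have "\<dots> = ln (fact (2 * n) / (fact n * fact n))"
  proof -
    have *: "ln x - 2 * ln y = ln (x / (y * y))" if "x > 0" "y > 0" for x y :: real
      using that by (simp add: ln_div ln_mult_pos)
    show ?thesis by (rule *) (rule fact_gt_zero)+
  qed
  also have "fact (2 * n) / (fact n * fact n) = real (2 * n choose n)"
    using binomial_fact[of n "2 * n", where 'a = real] by (simp only: mult_2 diff_add_inverse le_add1)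
  also have "ln (real (2 * n choose n)) \<le> ln (2 ^ (2 * n))"
  proof (rule ln_mono)
    show "0 < real (2 * n choose n)" by (simp add: zero_less_binomial)
    have "real (2 * n choose n) \<le> real (2 ^ (2 * n))"
      by (simp only: of_nat_le_iff binomial_le_pow2)
    thus "real (2 * n choose n) \<le> 2 ^ (2 * n)" by simp
  qed
  finally show ?thesis by (simp add: ln_realpow)
qed

lemma psi_le: "(\<Sum>d=1..n. \<Lambda> d) \<le> 4 * real n"
proof (induction n rule: less_induct)
  case (less n)
  show ?case
  proof (cases "n \<le> 1")
    case True
    thus ?thesis by (cases n) auto
  next
    case False
    define m where "m = (n + 1) div 2"
    have m: "m < n" "n \<le> 2 * m" "2 * m \<le> n + 1" using False by (auto simp: m_def)
    have "(\<Sum>d=1..n. \<Lambda> d) \<le> (\<Sum>d=1..2*m. \<Lambda> d)"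
      using m mangoldt_nonneg by (intro sum_mono2) auto
    also have "\<dots> \<le> 2 * real m * ln 2 + (\<Sum>d=1..m. \<Lambda> d)" using psi_double[of m] by simp
    also have "\<dots> \<le> 2 * real m * 1 + 4 * real m"
      using less[OF m(1)] ln_2_less_1 by (intro add_mono mult_left_mono) auto
    also have "\<dots> \<le> 4 * real n"
    \<comment> \<open>6 * m \<le> 3 * n + 3 is at most 4 * n only from n = 3 on.\<close>
    proof (cases "n = 2")
      case True
      hence "m = 1" using m by simp
      thus ?thesis using True by simp
    next
      case False
      hence "n \<ge> 3" using \<open>\<not> n \<le> 1\<close> by simp
      thus ?thesis using m(3) by linarith
    qed
    finally show ?thesis by simp
  qed
qed

lemma real_div_bounds:
  assumes "d > 0"
  shows "real (n div d) \<le> real n / d" "real n / d < real (n div d) + 1"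
proof -
  have "real n = real (n div d) * d + real (n mod d)"
    by (metis of_nat_add of_nat_mult div_mult_mod_eq)
  moreover have "n mod d < d" using assms by simp
  ultimately show "real (n div d) \<le> real n / d" "real n / d < real (n div d) + 1"
    using assms by (auto simp: field_simps)
qed

text \<open>\<open>N / d\<close> exceeds \<open>N div d\<close> by less than 1, so N times the sum
  exceeds ln N! by at most \<psi>(N) \<le> 4 * N.\<close>

lemma mertens_upper:
  assumes "N > 0"
  shows "(\<Sum>d=1..N. \<Lambda> d / d) \<le> ln N + 4"
proof -
  have "real N * (\<Sum>d=1..N. \<Lambda> d / d) = (\<Sum>d=1..N. \<Lambda> d * (real N / d))"
    by (simp add: sum_distrib_left mult_ac)
  also have "\<dots> \<le> (\<Sum>d=1..N. \<Lambda> d * (real (N div d) + 1))"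
    using real_div_bounds(2)[of _ N]
    by (intro sum_mono mult_left_mono) (auto simp: mangoldt_nonneg less_imp_le)
  also have "\<dots> = ln (fact N) + (\<Sum>d=1..N. \<Lambda> d)"
    unfolding ln_fact_conv_mangoldt by (simp add: algebra_simps sum.distrib)
  also have "\<dots> \<le> real N * ln N + 4 * real N" using ln_fact_le[of N] psi_le[of N] by simp
  also have "\<dots> = real N * (ln N + 4)" by (simp add: algebra_simps)
  finally show ?thesis using assms by (subst (asm) mult_le_cancel_left_pos) auto
qed

text \<open>Dropping the floor in \<open>N div d\<close> only enlarges the sum, so the lower bound
  for ln N! suffices.\<close>

lemma mertens_lower:
  assumes "N > 0"
  shows "(\<Sum>d=1..N. \<Lambda> d / d) \<ge> ln N - 1"
proof -
  have "real N * ln N - N \<le> ln (fact N)" by (rule ln_fact_ge)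
  also have "\<dots> \<le> (\<Sum>d=1..N. \<Lambda> d * (real N / d))" unfolding ln_fact_conv_mangoldt
    using real_div_bounds(1)[of _ N]
    by (intro sum_mono mult_left_mono) (auto simp: mangoldt_nonneg less_imp_le)
  also have "\<dots> = real N * (\<Sum>d=1..N. \<Lambda> d / d)"
    by (simp add: sum_distrib_left mult_ac)
  finally have "real N * (ln N - 1) \<le> real N * (\<Sum>d=1..N. \<Lambda> d / d)" by (simp add: algebra_simps)
  thus ?thesis using assms by (subst (asm) mult_le_cancel_left_pos) auto
qed

section \<open>Contributions of prime powers\<close>

lemma geometric_tail_le:
  fixes x :: real assumes "0 \<le> x" "x \<le> 1/2"
  shows "(\<Sum>k=a..b. x ^ k) \<le> 2 * x ^ a"
proof -
  have "(\<Sum>k=a..b. x ^ k) \<le> (\<Sum>k=a..<a+Suc b. x ^ k)"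
    using assms by (intro sum_mono2) auto
  also have "\<dots> = x ^ a * (\<Sum>k<Suc b. x ^ k)"
    unfolding sum_distrib_left by (rule sum.reindex_bij_witness[of _ "\<lambda>k. k + a" "\<lambda>k. k - a"]) (auto simp: power_add[symmetric])
  also have "(\<Sum>k<Suc b. x ^ k) \<le> 2"
  proof -
    have "(1 - x) * (\<Sum>k<Suc b. x ^ k) \<le> 1" using assms by (subst one_diff_power_eq[symmetric]) auto
    moreover have "(1/2) * (\<Sum>k<Suc b. x ^ k) \<le> (1 - x) * (\<Sum>k<Suc b. x ^ k)"
      using assms by (intro mult_right_mono sum_nonneg) auto
    ultimately show ?thesis by simp
  qed
  finally show ?thesis using assms by (simp add: mult_left_mono mult.commute[of 2])
qed

text \<open>Each prime p contributes at most a geometric series of ratio 1 / p \<le> 1 / 2 starting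
  at exponent \<open>a\<close>. The case a = 1 serves the primes dividing the modulus, the case a =
  2 the proper prime powers.\<close>

lemma sum_mangoldt_prime_powers_le:
  assumes "finite S" "finite Q" "\<forall>p\<in>Q. prime p"
      and "\<And>n. n \<in> S \<Longrightarrow> primepow n \<Longrightarrow> \<exists>p\<in>Q. \<exists>k\<ge>a. n = p ^ k"
  shows "(\<Sum>n\<in>S. \<Lambda> n / n) \<le> (\<Sum>p\<in>Q. 2 * ln (real p) / real p ^ a)"
proof -
  \<comment> \<open>As k < p ^ k, a bound for the elements of \<open>S\<close> also bounds the
    exponents.\<close>
  define K where "K = Max (insert 0 S)"
  define S' where "S' = {n\<in>S. primepow n}"
  have "(\<Sum>n\<in>S. \<Lambda> n / n) = (\<Sum>n\<in>S'. \<Lambda> n / n)"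
    using assms(1) by (intro sum.mono_neutral_right) (auto simp: S'_def mangoldt_def)
  also have "\<dots> \<le> (\<Sum>n\<in>(\<lambda>(p,k). p ^ k) ` (Q \<times> {a..K}). \<Lambda> n / n)"
  proof (intro sum_mono2 subsetI)
    fix n assume n: "n \<in> S'"
    then obtain p k where pk: "p \<in> Q" "k \<ge> a" "n = p ^ k" using assms(4)[of n] by (auto simp: S'_def)
    have "n \<le> K" using n assms(1) by (auto simp: K_def S'_def)
    moreover have "k < n" using pk assms(3) prime_gt_1_nat[of p] power_gt_expt[of p k] by auto
    ultimately show "n \<in> (\<lambda>(p,k). p ^ k) ` (Q \<times> {a..K})" using pk by auto
  qed (use assms in \<open>auto simp: mangoldt_nonneg\<close>)
  also have "\<dots> \<le> (\<Sum>i\<in>Q \<times> {a..K}. ((\<lambda>n. \<Lambda> n / n) \<circ> (\<lambda>(p,k). p ^ k)) i)"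
    using assms by (intro sum_image_le) (auto simp: mangoldt_nonneg)
  also have "\<dots> = (\<Sum>p\<in>Q. \<Sum>k=a..K. \<Lambda> (p ^ k) / real p ^ k)"
    by (simp add: sum.cartesian_product case_prod_unfold)
  also have "\<dots> \<le> (\<Sum>p\<in>Q. 2 * ln (real p) / real p ^ a)"
  proof (intro sum_mono)
    fix p assume "p \<in> Q"
    hence p: "prime p" using assms by auto
    hence p2: "p \<ge> 2" by (rule prime_ge_2_nat)
    have "(\<Sum>k=a..K. \<Lambda> (p ^ k) / real p ^ k) \<le> (\<Sum>k=a..K. ln p * (1 / p) ^ k)"
      using p p2 by (intro sum_mono) (auto simp: mangoldt_primepow power_divide)
    also have "\<dots> = ln p * (\<Sum>k=a..K. (1 / p) ^ k)" by (simp add: sum_distrib_left)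
    also have "\<dots> \<le> ln p * (2 * (1 / p) ^ a)"
      using p2 by (intro mult_left_mono geometric_tail_le) (auto simp: field_simps)
    finally show "(\<Sum>k=a..K. \<Lambda> (p ^ k) / real p ^ k) \<le> 2 * ln (real p) / real p ^ a"
      by (simp add: power_divide mult.commute)
  qed
  finally show ?thesis .
qed

lemma sum_ln_over_square_le: "(\<Sum>n=1..N. ln (real n) / real n ^ 2) \<le> 3"
proof -
  \<comment> \<open>The subtracted term imitates the tail integral (ln N + 1) / N of ln x / x ^ 2;
    the constant 2 instead of 1 makes the numerator \<open>x - 1\<close> in the induction step
    nonnegative.\<close>
  have "(\<Sum>n=1..N. ln (real n) / real n ^ 2) \<le> 3 - (ln N + 2) / N" if "N > 0" for N :: nat
    using that
  proof (induction N rule: nat_induct_non_zero)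
    case (Suc n)
    define x where "x = real n"
    have x: "x \<ge> 1" using Suc by (simp add: x_def)
    have "ln (x + 1) - ln x = ln ((x + 1) / x)"
      using x by (subst ln_div) auto
    also have "(x + 1) / x = 1 + 1 / x"
      using x by (simp add: field_simps)
    also have "ln (1 + 1 / x) \<le> 1 / x"
      using x by (intro ln_add_one_self_le_self) simp
    finally have l: "ln (x + 1) - 1 / x \<le> ln x" by simp
    have "ln (x+1) / (x+1)^2 \<le> ln (x+1) / (x * (x+1))"
      using x by (intro divide_left_mono) (auto simp: power2_eq_square)
    also have "\<dots> \<le> (ln (x + 1) - 1 / x + 2) / x - (ln (x+1) + 2) / (x+1)"
    proof -
      have "(ln (x + 1) - 1 / x + 2) / x - (ln (x+1) + 2) / (x+1) - ln (x+1) / (x * (x+1)) = (x - 1) / (x^2 * (x+1))"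
        using x by (simp add: divide_simps power2_eq_square) (simp add: algebra_simps)
      moreover have "\<dots> \<ge> 0" using x by simp
      ultimately show ?thesis by linarith
    qed
    also have "\<dots> \<le> (ln x + 2) / x - (ln (x+1) + 2) / (x+1)"
      using l x by (intro diff_right_mono divide_right_mono) auto
    finally show ?case using Suc by (simp add: x_def algebra_simps)
  qed simp
  from this[of N] show ?thesis by (cases "N = 0") (force intro: order_trans)+
qed

section \<open>The Moebius function and Dirichlet characters\<close>

text \<open>Summation by parts: the weights decrease, so their differences telescope to f m - f N,
  and the boundary terms add f N + f m. Monotonicity is asked only from \<open>m\<close> on because
  ln n / n does not decrease from the start.\<close>

lemma Abel_bound:
  fixes a :: "nat \<Rightarrow> 'a::real_normed_vector" and f :: "nat \<Rightarrow> real"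
  assumes K: "\<And>N. norm (\<Sum>n<N. a n) \<le> K"
    and decr: "\<And>i j. m \<le> i \<Longrightarrow> i \<le> j \<Longrightarrow> f j \<le> f i"
    and nonneg: "\<And>i. m \<le> i \<Longrightarrow> 0 \<le> f i"
  shows "norm (\<Sum>n=m..<N. f n *\<^sub>R a n) \<le> 2 * K * f m"
proof (cases "m \<le> N")
  case True
  define s where "s = (\<lambda>n. \<Sum>k<n. a k)"
  have sK: "norm (s n) \<le> K" for n using K by (simp add: s_def)
  have "(\<Sum>n=m..<N. f n *\<^sub>R a n) = f N *\<^sub>R s N - f m *\<^sub>R s m + (\<Sum>n=m..<N. (f n - f (Suc n)) *\<^sub>R s (Suc n))"
    using True by (induction N rule: dec_induct) (simp_all add: s_def algebra_simps)
  also have "norm \<dots> \<le> f N * K + f m * K + (\<Sum>n=m..<N. (f n - f (Suc n)) * K)"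
    using True sK
    by (intro order_trans[OF norm_triangle_ineq] order_trans[OF norm_triangle_ineq4] add_mono
          sum_norm_le) (auto simp: nonneg decr intro!: mult_left_mono)
  also have "(\<Sum>n=m..<N. (f n - f (Suc n)) * K) = (f m - f N) * K"
    using True by (induction N rule: dec_induct) (simp_all add: algebra_simps)
  finally show ?thesis by (simp add: algebra_simps)
next
  case False
  have "0 \<le> K" using K[of 0] by simp
  thus ?thesis using False nonneg[of m] by simp
qed

definition moebius :: "nat \<Rightarrow> real" where
  "moebius n = (if squarefree n then (-1) ^ card (prime_factors n) else 0)"

lemma abs_moebius_le: "\<bar>moebius n\<bar> \<le> 1"
  by (simp add: moebius_def)

text \<open>For a prime p dividing n, multiplication by p matches the squarefree divisors prime to p
  with those divisible by p and flips the sign.\<close>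

lemma sum_moebius:
  assumes "n > 0"
  shows "(\<Sum>d | d dvd n. moebius d) = (if n = 1 then 1 else 0)"
proof (cases "n = 1")
  case False
  then obtain p where p: "prime p" "p dvd n" by (meson prime_factor_nat)
  define A where "A = {d. d dvd n \<and> squarefree d \<and> \<not> p dvd d}"
  define B where "B = {d. d dvd n \<and> squarefree d \<and> p dvd d}"
  have fin: "finite A" "finite B" using assms by (auto simp: A_def B_def)
  have "(\<Sum>d | d dvd n. moebius d) = (\<Sum>d\<in>A \<union> B. moebius d)"
    using assms by (intro sum.mono_neutral_right) (auto simp: A_def B_def moebius_def)
  also have "\<dots> = (\<Sum>d\<in>A. moebius d) + (\<Sum>d\<in>B. moebius d)"
    using fin by (intro sum.union_disjoint) (auto simp: A_def B_def)
  also have "(\<Sum>d\<in>B. moebius d) = (\<Sum>d\<in>A. moebius (p * d))"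
  proof (rule sum.reindex_bij_witness[of _ "\<lambda>d. p * d" "\<lambda>d. d div p"])
    fix d assume "d \<in> A"
    hence d: "d dvd n" "squarefree d" "\<not> p dvd d" by (auto simp: A_def)
    hence "coprime p d" using p by (simp add: prime_imp_coprime)
    thus "p * d \<in> B"
      using d p by (auto simp: B_def divides_mult squarefree_mult_coprime squarefree_prime)
  next
    fix d assume "d \<in> B"
    then obtain e where e: "d = p * e" "p * e dvd n" "squarefree (p * e)" by (auto simp: B_def)
    have "\<not> p dvd e"
    proof
      assume "p dvd e"
      hence "p ^ 2 dvd p * e" by (simp add: power2_eq_square)
      thus False using e(3) p squarefreeD[of "p * e" p] by simp
    qed
    moreover have "squarefree e" using e(3) by (rule squarefree_multD)
    ultimately show "d div p \<in> A" using e p by (auto simp: A_def dvd_mult_right)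
  qed (use p in \<open>auto simp: A_def B_def\<close>)
  also have "\<dots> = (\<Sum>d\<in>A. - moebius d)"
  proof (intro sum.cong refl)
    fix d assume "d \<in> A"
    hence d: "d dvd n" "squarefree d" "\<not> p dvd d" by (auto simp: A_def)
    hence "coprime p d" using p by (simp add: prime_imp_coprime)
    hence "squarefree (p * d)" using d p by (simp add: squarefree_mult_coprime squarefree_prime)
    moreover have "d > 0" using d assms by (auto intro: Nat.gr0I)
    hence "prime_factors (p * d) = insert p (prime_factors d)"
      using p by (simp add: prime_factors_product prime_factorization_prime)
    moreover have "p \<notin> prime_factors d" using d by auto
    ultimately show "moebius (p * d) = - moebius d" using d by (simp add: moebius_def)
  qed
  finally show ?thesis using False by (simp add: sum_negf)
qed (simp add: moebius_def)

text \<open>Moebius inversion of ln n = \<Sum> \<Lambda> e over e dvd n: after exchanging the sums,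
  the inner sum runs over the divisors of n / e and vanishes unless e = n.\<close>

lemma sum_moebius_ln:
  assumes "n > 0"
  shows "(\<Sum>d | d dvd n. moebius d * ln (real (n div d))) = \<Lambda> n"
proof -
  have "(\<Sum>d | d dvd n. moebius d * ln (real (n div d)))
      = (\<Sum>d | d dvd n. \<Sum>e | e \<in> {e. e dvd n} \<and> d * e dvd n. moebius d * \<Lambda> e)"
  proof (intro sum.cong refl)
    fix d assume "d \<in> {d. d dvd n}"
    then obtain k where k: "n = d * k" by auto
    hence "{e \<in> {e. e dvd n}. d * e dvd n} = {e. e dvd n div d}" using assms by auto
    thus "moebius d * ln (real (n div d)) = (\<Sum>e | e \<in> {e. e dvd n} \<and> d * e dvd n. moebius d * \<Lambda> e)"
      using k assms mangoldt_sum[of "n div d", where 'a = real] by (auto simp: sum_distrib_left[symmetric])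
  qed
  also have "\<dots> = (\<Sum>e | e dvd n. \<Sum>d | d \<in> {d. d dvd n} \<and> d * e dvd n. moebius d * \<Lambda> e)"
    using assms by (intro sum.swap_restrict) auto
  also have "\<dots> = (\<Sum>e | e dvd n. if e = n then \<Lambda> e else 0)"
  proof (intro sum.cong refl)
    fix e assume "e \<in> {e. e dvd n}"
    then obtain k where k: "n = e * k" by auto
    hence "{d \<in> {d. d dvd n}. d * e dvd n} = {d. d dvd k}" using assms by (auto simp: mult.commute)
    thus "(\<Sum>d | d \<in> {d. d dvd n} \<and> d * e dvd n. moebius d * \<Lambda> e) = (if e = n then \<Lambda> e else 0)"
      using k assms sum_moebius[of k] by (auto simp: sum_distrib_right[symmetric])
  qed
  also have "\<dots> = \<Lambda> n" using assms by simp
  finally show ?thesis .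
qed

text \<open>A Dirichlet character modulo \<open>q\<close>, extended by 0 to all natural numbers. The
  value 1 at 1 follows from \<open>mult\<close> and \<open>nonzero_iff\<close>.\<close>

locale residue_character =
  fixes q :: nat and \<chi> :: "nat \<Rightarrow> complex"
  assumes q_pos: "q > 0"
    and mult: "\<chi> (m * n) = \<chi> m * \<chi> n"
    and periodic: "\<chi> (n + q) = \<chi> n"
    and nonzero_iff: "\<chi> n \<noteq> 0 \<longleftrightarrow> coprime n q"
begin

lemma one [simp]: "\<chi> 1 = 1" "\<chi> (Suc 0) = 1"
  using mult[of 1 1] nonzero_iff[of 1] by auto

lemma power: "\<chi> (n ^ k) = \<chi> n ^ k"
  by (induction k) (auto simp: mult)

lemma periodic_mult: "\<chi> (n + k * q) = \<chi> n"
proof (induction k)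
  case (Suc k)
  thus ?case using periodic[of "n + k * q"] by (simp add: ac_simps)
qed simp

lemma mod [simp]: "\<chi> (n mod q) = \<chi> n"
  using periodic_mult[of "n mod q" "n div q"] by simp

lemma norm_eq_1:
  assumes "coprime n q"
  shows "norm (\<chi> n) = 1"
proof -
  have "\<chi> (n ^ totient q mod q) = \<chi> (1 mod q)"
    using euler_theorem[OF assms] by (simp only: cong_def)
  hence "\<chi> n ^ totient q = 1" by (simp only: mod power one)
  thus ?thesis using q_pos power_eq_1_iff by fastforce
qed

lemma norm_le_1: "norm (\<chi> n) \<le> 1"
  using norm_eq_1[of n] nonzero_iff[of n] by (cases "coprime n q") auto

lemma norm_term_le: "norm (\<chi> n * of_real c / of_nat n) \<le> \<bar>c\<bar> / n"
  by (simp add: norm_mult norm_divide divide_right_mono mult_left_le_one_le norm_le_1)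

end

lemma sum_lessThan_add:
  fixes f :: "nat \<Rightarrow> 'a::comm_monoid_add"
  shows "(\<Sum>n<k + m. f n) = (\<Sum>n<k. f n) + (\<Sum>n<m. f (n + k))"
  by (induction m) (simp_all add: ac_simps)

section \<open>L(1,\<chi>) and Mertens sums for a nonprincipal character\<close>

locale nonprincipal_character = residue_character +
  assumes nonprincipal: "\<exists>a. coprime a q \<and> \<chi> a \<noteq> 1"
begin

text \<open>Multiplication by a unit a with \<chi> a \<noteq> 1 permutes the residues and multiplies
  the sum by \<chi> a.\<close>

lemma sum_period: "(\<Sum>r<q. \<chi> r) = 0"
proof -
  obtain a where a: "coprime a q" "\<chi> a \<noteq> 1" using nonprincipal by auto
  have "inj_on (\<lambda>r. a * r mod q) {..<q}"
  proof (rule inj_onI)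
    fix x y assume xy: "x \<in> {..<q}" "y \<in> {..<q}" "a * x mod q = a * y mod q"
    hence "[x = y] (mod q)" using a(1) by (metis cong_def cong_mult_lcancel_nat)
    thus "x = y" using xy by (simp add: cong_def)
  qed
  moreover have "(\<lambda>r. a * r mod q) ` {..<q} \<subseteq> {..<q}" using q_pos by auto
  ultimately have "bij_betw (\<lambda>r. a * r mod q) {..<q} {..<q}"
    by (simp add: bij_betw_def endo_inj_surj)
  hence "(\<Sum>r<q. \<chi> r) = (\<Sum>r<q. \<chi> (a * r mod q))" by (rule sum.reindex_bij_betw[symmetric])
  also have "\<dots> = \<chi> a * (\<Sum>r<q. \<chi> r)" by (simp add: mult sum_distrib_left)
  finally show ?thesis using a(2) by (simp add: algebra_simps)
qed

lemma norm_partial_sum_le: "norm (\<Sum>n<N. \<chi> n) \<le> q"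
proof (induction N rule: less_induct)
  case (less N)
  show ?case
  proof (cases "N < q")
    case True
    have "norm (\<Sum>n<N. \<chi> n) \<le> (\<Sum>n<N. 1)" by (intro sum_norm_le norm_le_1)
    thus ?thesis using True by simp
  next
    case False
    have "(\<Sum>n<N. \<chi> n) = (\<Sum>n<q + (N - q). \<chi> n)" using False by simp
    also have "\<dots> = (\<Sum>n<N - q. \<chi> n)"
      by (simp only: sum_lessThan_add periodic sum_period add_0_left)
    finally show ?thesis using less[of "N - q"] False q_pos by simp
  qed
qed

definition S :: "nat \<Rightarrow> complex" where "S N = (\<Sum>n=1..N. \<chi> n / n)"

definition L :: complex where "L = lim S"

text \<open>Formally the partial sums of -L'/L at 1.\<close>

definition V :: "nat \<Rightarrow> complex" where "V N = (\<Sum>n=1..N. \<chi> n * \<Lambda> n / n)"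

lemma norm_S_diff_le:
  assumes "N \<le> M"
  shows "norm (S M - S N) \<le> 2 * real q / (real N + 1)"
proof -
  have "S M - S N = (\<Sum>n\<in>{1..M}-{1..N}. \<chi> n / n)"
    unfolding S_def using assms by (subst sum_diff) auto
  also have "{1..M}-{1..N} = {Suc N..<Suc M}" by auto
  also have "(\<Sum>n\<in>\<dots>. \<chi> n / n) = (\<Sum>n=Suc N..<Suc M. (1 / real n) *\<^sub>R \<chi> n)"
    by (intro sum.cong) (auto simp: scaleR_conv_of_real)
  also have "norm \<dots> \<le> 2 * real q * (1 / real (Suc N))"
    by (rule Abel_bound) (auto intro: norm_partial_sum_le simp: field_simps)
  finally show ?thesis by (simp add: add.commute)
qed

lemma S_tendsto: "S \<longlonglongrightarrow> L"
proof -
  have "Cauchy S"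
  proof (rule CauchyI')
    fix e :: real assume "e > 0"
    obtain M :: nat where M: "2 * real q / e < M" using reals_Archimedean2 by blast
    have "norm (S m - S n) < e" if "M \<le> m" "m < n" for m n
    proof -
      have "norm (S m - S n) \<le> 2 * real q / (real m + 1)"
        using norm_S_diff_le[of m n] that by (simp add: norm_minus_commute)
      also have "2 * real q < e * (real m + 1)"
        using M that(1) \<open>e > 0\<close> by (simp add: field_simps) (smt (verit) mult_left_mono of_nat_le_iff)
      hence "2 * real q / (real m + 1) < e" by (simp add: field_simps)
      finally show ?thesis .
    qed
    thus "\<exists>M. \<forall>m\<ge>M. \<forall>n>m. dist (S m) (S n) < e" by (auto simp: dist_norm)
  qed
  thus ?thesis unfolding L_def by (simp add: Cauchy_convergent convergent_LIMSEQ_iff[symmetric])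
qed

lemma norm_L_diff_le: "norm (L - S N) \<le> 2 * real q / (real N + 1)"
proof (rule Lim_bounded)
  show "(\<lambda>M. norm (S M - S N)) \<longlonglongrightarrow> norm (L - S N)"
    by (intro tendsto_intros S_tendsto)
  show "\<forall>M\<ge>N. norm (S M - S N) \<le> 2 * real q / (real N + 1)"
    using norm_S_diff_le by blast
qed

text \<open>The bound is linear in d so that it cancels the 1 / d of the weights in the convolution
  sums below.\<close>

lemma norm_L_diff_div_le:
  assumes "d \<in> {1..N}"
  shows "norm (L - S (N div d)) \<le> 2 * real q * d / N"
proof -
  have "real N / d \<le> real (N div d) + 1" using real_div_bounds(2)[of d N] assms by simp
  hence "2 * real q / (real (N div d) + 1) \<le> 2 * real q / (real N / d)"
    using assms by (intro divide_left_mono) (auto intro!: mult_pos_pos)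
  thus ?thesis using norm_L_diff_le[of "N div d"] by (simp add: add.commute)
qed

lemma bounded_sum_ln: "\<exists>C. \<forall>N. norm (\<Sum>n=1..N. \<chi> n * ln n / n) \<le> C"
proof (intro exI allI)
  fix N
  let ?f = "\<lambda>n. \<chi> n * ln (real n) / n"
  \<comment> \<open>ln x / x decreases only from x = e on, and e \<le> 3.\<close>
  have "(\<Sum>n=1..N. ?f n) = (\<Sum>n\<in>{1..N}\<inter>{..<3}. ?f n) + (\<Sum>n=3..<Suc N. ?f n)"
    by (subst sum.union_disjoint[symmetric]) (auto intro: sum.cong)
  also have "(\<Sum>n=3..<Suc N. ?f n) = (\<Sum>n=3..<Suc N. (ln (real n) / n) *\<^sub>R \<chi> n)"
    by (intro sum.cong) (auto simp: scaleR_conv_of_real)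
  finally have "norm (\<Sum>n=1..N. ?f n)
      \<le> norm (\<Sum>n\<in>{1..N}\<inter>{..<3}. ?f n) + norm (\<Sum>n=3..<Suc N. (ln (real n) / n) *\<^sub>R \<chi> n)"
    by (simp only: norm_triangle_ineq)
  moreover have "norm (\<Sum>n\<in>{1..N}\<inter>{..<3}. ?f n) \<le> (\<Sum>n<3. norm (?f n))"
    by (intro order_trans[OF norm_sum] sum_mono2) auto
  moreover have "norm (\<Sum>n=3..<Suc N. (ln (real n) / n) *\<^sub>R \<chi> n) \<le> 2 * real q * (ln (real 3) / real 3)"
  proof (rule Abel_bound)
    fix i j :: nat assume "3 \<le> i" "i \<le> j"
    thus "ln (real j) / j \<le> ln (real i) / i"
      using exp_le by (intro ln_x_over_x_mono) auto
  qed (auto intro: norm_partial_sum_le)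
  ultimately show "norm (\<Sum>n=1..N. ?f n) \<le> (\<Sum>n<3. norm (?f n)) + 2 * real q * (ln (real 3) / real 3)"
    by linarith
qed

text \<open>Complete multiplicativity splits \<chi> n / n over n = d * m, so that the cofactors m
  add up to \<open>S (N div d)\<close>.\<close>

lemma sum_convolution:
  fixes g :: "nat \<Rightarrow> real"
  shows "(\<Sum>n=1..N. \<chi> n / n * of_real (\<Sum>d | d dvd n. g d)) = (\<Sum>d=1..N. \<chi> d * g d / d * S (N div d))"
proof -
  have "(\<Sum>n=1..N. \<chi> n / n * of_real (\<Sum>d | d dvd n. g d))
      = (\<Sum>n=1..N. \<Sum>d | d dvd n. \<chi> d * g d / d * (\<chi> (n div d) / (n div d)))"
  proof (intro sum.cong refl)
    fix n assume n: "n \<in> {1..N}"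
    have "\<chi> n / n * of_real (g d) = \<chi> d * g d / d * (\<chi> (n div d) / (n div d))" if d: "d dvd n" for d
    proof -
      obtain k where k: "n = d * k" using d by (elim dvdE)
      show ?thesis using k n by (simp add: mult)
    qed
    thus "\<chi> n / n * of_real (\<Sum>d | d dvd n. g d) = (\<Sum>d | d dvd n. \<chi> d * g d / d * (\<chi> (n div d) / (n div d)))"
      by (simp add: sum_distrib_left)
  qed
  also have "\<dots> = (\<Sum>d=1..N. \<Sum>m=1..N div d. \<chi> d * g d / d * (\<chi> m / m))"
    by (rule sum_divisors_swap)
  also have "\<dots> = (\<Sum>d=1..N. \<chi> d * g d / d * S (N div d))"
    by (simp add: S_def sum_distrib_left)
  finally show ?thesis .
qed

text \<open>Expanding ln n into \<Lambda> gives the bounded sum \<Sum> \<chi> n * ln n / n as a sum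
  of \<chi> d * \<Lambda> d / d times \<open>S (N div d)\<close>. Replacing
  \<open>S (N div d)\<close> by \<open>L\<close> costs O(\<psi>(N) / N) = O(1), so L * V N is
  bounded.\<close>

lemma bounded_if_L_nonzero:
  assumes "L \<noteq> 0"
  shows "\<exists>C. \<forall>N. norm (V N) \<le> C"
proof -
  obtain C where C: "\<And>N. norm (\<Sum>n=1..N. \<chi> n * ln n / n) \<le> C" using bounded_sum_ln by auto
  have "norm (V N) \<le> (C + 8 * real q) / norm L" for N
  proof -
    have "(\<Sum>n=1..N. \<chi> n * ln n / n) = (\<Sum>n=1..N. \<chi> n / n * of_real (\<Sum>d | d dvd n. \<Lambda> d))"
      by (intro sum.cong) (auto simp: mangoldt_sum)
    also have "\<dots> = (\<Sum>d=1..N. \<chi> d * \<Lambda> d / d * S (N div d))" by (rule sum_convolution)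
    also have "\<dots> = L * V N - (\<Sum>d=1..N. \<chi> d * \<Lambda> d / d * (L - S (N div d)))"

      unfolding V_def sum_distrib_left sum_subtractf[symmetric] by (intro sum.cong) (auto simp: algebra_simps diff_divide_distrib)
    finally have "norm (L * V N) \<le> C + norm (\<Sum>d=1..N. \<chi> d * \<Lambda> d / d * (L - S (N div d)))"
      using C[of N] norm_triangle_sub by (smt (verit) norm_minus_commute)
    also have "norm (\<Sum>d=1..N. \<chi> d * \<Lambda> d / d * (L - S (N div d))) \<le> (\<Sum>d=1..N. \<Lambda> d / d * (2 * real q * d / N))"
    proof (intro sum_norm_le)
      fix d assume "d \<in> {1..N}"
      thus "norm (\<chi> d * \<Lambda> d / d * (L - S (N div d))) \<le> \<Lambda> d / d * (2 * real q * d / N)"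
        unfolding norm_mult[of "\<chi> d * \<Lambda> d / d"]
        using norm_term_le[of d "\<Lambda> d"] norm_L_diff_div_le[of d N] mangoldt_nonneg[of d]
        by (intro mult_mono) auto
    qed
    also have "\<dots> = 2 * real q / N * (\<Sum>d=1..N. \<Lambda> d)"
      unfolding sum_distrib_left by (intro sum.cong) auto
    also have "\<dots> \<le> 2 * real q / N * (4 * real N)" by (intro mult_left_mono psi_le) auto
    also have "\<dots> \<le> 8 * real q" by simp
    finally show ?thesis using assms by (simp add: norm_mult field_simps)
  qed
  thus ?thesis by blast
qed

text \<open>With ln (N / d) in place of ln (n / d), Moebius inversion yields \<Lambda> n plus an
  extra ln N at n = 1. As L = 0, \<open>S (N div d)\<close> is itself O(d / N), and the sum of ln N
  - ln d is at most N.\<close>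

lemma bounded_if_L_zero:
  assumes "L = 0" "N > 0"
  shows "norm (V N + ln N) \<le> 2 * real q"
proof -
  have "V N + ln N = (\<Sum>n=1..N. \<chi> n / n * (\<Lambda> n + (if n = 1 then ln N else 0)))"

  proof -
    have "(\<Sum>n=1..N. \<chi> n / n * (\<Lambda> n + (if n = 1 then ln N else 0)))
        = (\<Sum>n=1..N. \<chi> n * \<Lambda> n / n + (if n = 1 then complex_of_real (ln N) else 0))"
      by (intro sum.cong) (auto simp: algebra_simps)
    also have "\<dots> = V N + ln N"
      unfolding V_def sum.distrib using assms(2) by simp
    finally show ?thesis ..
  qed
  also have "\<dots> = (\<Sum>n=1..N. \<chi> n / n * of_real (\<Sum>d | d dvd n. moebius d * ln (real N / d)))"
  proof (intro sum.cong refl arg_cong2[where f = "(*)"] arg_cong[where f = of_real])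
    fix n assume n: "n \<in> {1..N}"
    have "(\<Sum>d | d dvd n. moebius d * ln (real N / d)) = (\<Sum>d | d dvd n. moebius d * (ln (real N / n) + ln (n div d)))"
    proof (intro sum.cong refl arg_cong2[where f = "(*)"])
      fix d assume "d \<in> {d. d dvd n}"
      then obtain k where k: "n = d * k" by auto
      hence "real N / d = real N / n * (n div d)" using n by auto
      also have "ln \<dots> = ln (real N / n) + ln (n div d)"
        using n k assms(2) by (intro ln_mult_pos divide_pos_pos) auto
      finally show "ln (real N / d) = ln (real N / n) + ln (n div d)" .
    qed
    also have "\<dots> = ln (real N / n) * (\<Sum>d | d dvd n. moebius d) + (\<Sum>d | d dvd n. moebius d * ln (real (n div d)))"
      by (simp add: algebra_simps sum.distrib sum_distrib_left)
    also have "\<dots> = \<Lambda> n + (if n = 1 then ln N else 0)"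
      using n by (simp add: sum_moebius_ln sum_moebius)
    finally show "\<Lambda> n + (if n = 1 then ln N else 0) = (\<Sum>d | d dvd n. moebius d * ln (real N / d))" ..
  qed
  also have "\<dots> = (\<Sum>d=1..N. \<chi> d * (moebius d * ln (real N / d)) / d * S (N div d))"
    by (subst sum_convolution) simp
  also have "norm \<dots> \<le> (\<Sum>d=1..N. ln (real N / d) / d * (2 * real q * d / N))"
  proof (intro sum_norm_le)
    fix d assume d: "d \<in> {1..N}"
    show "norm (\<chi> d * (moebius d * ln (real N / d)) / d * S (N div d)) \<le> ln (real N / d) / d * (2 * real q * d / N)"
      unfolding norm_mult[of "\<chi> d * c / d" for c]
    proof (rule mult_mono)
      have "\<bar>moebius d * ln (real N / d)\<bar> \<le> 1 * ln (real N / d)"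
        unfolding abs_mult using d abs_moebius_le[of d] by (intro mult_mono) auto
      thus "norm (\<chi> d * (moebius d * ln (real N / d)) / d) \<le> ln (real N / d) / d"
        by (intro order_trans[OF norm_term_le] divide_right_mono) auto
      show "norm (S (N div d)) \<le> 2 * real q * d / N"
        using norm_L_diff_div_le[OF d] assms(1) by simp
    qed (use d in auto)
  qed
  also have "\<dots> = 2 * real q / N * (\<Sum>d=1..N. ln N - ln d)"
    unfolding sum_distrib_left by (intro sum.cong) (use assms(2) in \<open>auto simp: ln_div\<close>)
  also have "(\<Sum>d=1..N. ln N - ln d) = N * ln N - ln (fact N)"
    unfolding ln_fact_conv_sum by (simp add: sum_subtractf)
  also have "2 * real q / N * \<dots> \<le> 2 * real q / N * N"
    using ln_fact_ge[of N] by (intro mult_left_mono) auto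
  finally show ?thesis using assms(2) by simp
qed

end

section \<open>Nonvanishing of L(1,\<chi>)\<close>

lemma sum_divisors_prime_power_mult:
  fixes f :: "nat \<Rightarrow> real"
  assumes p: "prime p" "\<not> p dvd m" and mult: "\<And>a b. f (a * b) = f a * f b" and one: "f 1 = 1"
  shows "(\<Sum>d | d dvd p ^ k * m. f d) = (\<Sum>i\<le>k. f p ^ i) * (\<Sum>d | d dvd m. f d)"
proof -
  have m: "m > 0" using p by (auto intro: Nat.gr0I)
  have pow: "f (a ^ i) = f a ^ i" for a i using one by (induction i) (auto simp: mult)
  \<comment> \<open>The exponent can be recovered from the product, which gives injectivity.\<close>
  have mp: "multiplicity p (p ^ i * d) = i" if "d dvd m" for i d
  proof -
    have "\<not> p dvd d" "d \<noteq> 0" using p that m by (auto dest: dvd_trans)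
    thus ?thesis using p by (simp add: prime_elem_multiplicity_mult_distrib not_dvd_imp_multiplicity_0)
  qed
  have "inj_on (\<lambda>(i,d). p ^ i * d) ({..k} \<times> {d. d dvd m})"
  proof (rule inj_onI)
    fix x y assume x: "x \<in> {..k} \<times> {d. d dvd m}" and y: "y \<in> {..k} \<times> {d. d dvd m}"
      and eq: "(\<lambda>(i,d). p ^ i * d) x = (\<lambda>(i,d). p ^ i * d) y"
    have "fst x = fst y" using mp[of "snd x" "fst x"] mp[of "snd y" "fst y"] x y eq by auto
    thus "x = y" using eq p by (auto simp: prod_eq_iff case_prod_unfold prime_gt_0_nat)
  qed
  moreover have "(\<lambda>(i,d). p ^ i * d) ` ({..k} \<times> {d. d dvd m}) = {d. d dvd p ^ k * m}"
  proof (intro equalityI subsetI)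
    fix x assume "x \<in> {d. d dvd p ^ k * m}"
    then obtain b c where bc: "x = b * c" "b dvd p ^ k" "c dvd m" using division_decomp by blast
    moreover obtain i where "i \<le> k" "b = p ^ i" using bc(2) p(1) divides_primepow_nat by blast
    ultimately show "x \<in> (\<lambda>(i,d). p ^ i * d) ` ({..k} \<times> {d. d dvd m})" by auto
  qed (auto intro!: mult_dvd_mono le_imp_power_dvd)
  ultimately have "bij_betw (\<lambda>(i,d). p ^ i * d) ({..k} \<times> {d. d dvd m}) {d. d dvd p ^ k * m}"
    by (simp add: bij_betw_def)
  hence "(\<Sum>d | d dvd p ^ k * m. f d) = (\<Sum>(i,d)\<in>{..k} \<times> {d. d dvd m}. f (p ^ i * d))"
    by (subst sum.reindex_bij_betw[symmetric]) (auto simp: case_prod_unfold)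
  also have "\<dots> = (\<Sum>i\<le>k. f p ^ i) * (\<Sum>d | d dvd m. f d)"
    by (simp add: sum_product sum.cartesian_product mult pow)
  finally show ?thesis .
qed

lemma sum_sign_powers:
  fixes x :: real
  assumes "x \<in> {-1, 0, 1}"
  shows "0 \<le> (\<Sum>i\<le>k. x ^ i)" "even k \<Longrightarrow> 1 \<le> (\<Sum>i\<le>k. x ^ i)"
proof -
  have "(\<Sum>i\<le>k. 0 ^ i) = (1::real)" by (induction k) auto
  moreover have "(\<Sum>i\<le>k. (-1) ^ i) = (if even k then 1 else 0::real)" by (induction k) auto
  ultimately show "0 \<le> (\<Sum>i\<le>k. x ^ i)" "even k \<Longrightarrow> 1 \<le> (\<Sum>i\<le>k. x ^ i)" using assms by auto
qed

lemma sum_divisors_sign_nonneg: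
  fixes f :: "nat \<Rightarrow> real"
  assumes mult: "\<And>a b. f (a * b) = f a * f b" and one: "f 1 = 1" and sgn: "\<And>n. f n \<in> {-1, 0, 1}"
    and "n > 0"
  shows "0 \<le> (\<Sum>d | d dvd n. f d)"
  using \<open>n > 0\<close>
proof (induction n rule: less_induct)
  case (less n)
  show ?case
  proof (cases "n = 1")
    case False
    then obtain p where p: "prime p" "p dvd n" by (meson prime_factor_nat)
    obtain m where m: "n = p ^ multiplicity p n * m" "\<not> p dvd m"
      using multiplicity_decompose'[of n p] p less.prems by (metis not_prime_unit not_gr_zero)
    have "m < n" using m p less.prems by (metis dvd_imp_le dvd_triv_right le_neq_implies_less)
    moreover have "m > 0" using m less.prems by (auto intro: Nat.gr0I)
    ultimately have "0 \<le> (\<Sum>d | d dvd m. f d)" by (rule less.IH)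
    thus ?thesis
      by (subst m(1), subst sum_divisors_prime_power_mult[where f = f])
        (use p m mult one sum_sign_powers(1)[OF sgn] in auto)
  qed (use one in auto)
qed

text \<open>All exponents in a square are even, so each Euler factor is at least 1, even at primes
  where f is -1.\<close>

lemma sum_divisors_sign_square:
  fixes f :: "nat \<Rightarrow> real"
  assumes mult: "\<And>a b. f (a * b) = f a * f b" and one: "f 1 = 1" and sgn: "\<And>n. f n \<in> {-1, 0, 1}"
    and "n > 0"
  shows "1 \<le> (\<Sum>d | d dvd n ^ 2. f d)"
  using \<open>n > 0\<close>
proof (induction n rule: less_induct)
  case (less n)
  show ?case
  proof (cases "n = 1")
    case False
    then obtain p where p: "prime p" "p dvd n" by (meson prime_factor_nat)
    obtain m where m: "n = p ^ multiplicity p n * m" "\<not> p dvd m"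
      using multiplicity_decompose'[of n p] p less.prems by (metis not_prime_unit not_gr_zero)
    have "m < n" using m p less.prems by (metis dvd_imp_le dvd_triv_right le_neq_implies_less)
    moreover have "m > 0" using m less.prems by (auto intro: Nat.gr0I)
    ultimately have "1 \<le> (\<Sum>d | d dvd m ^ 2. f d)" by (rule less.IH)
    moreover have "1 \<le> (\<Sum>i\<le>multiplicity p n * 2. f p ^ i)" by (intro sum_sign_powers(2)[OF sgn]) simp
    ultimately have "1 * 1 \<le> (\<Sum>i\<le>multiplicity p n * 2. f p ^ i) * (\<Sum>d | d dvd m ^ 2. f d)"
      by (intro mult_mono) auto
    also have "\<dots> = (\<Sum>d | d dvd p ^ (multiplicity p n * 2) * m ^ 2. f d)"
      using p m mult one by (subst sum_divisors_prime_power_mult[where f = f]) (auto dest: prime_dvd_power)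
    also have "p ^ (multiplicity p n * 2) * m ^ 2 = n ^ 2"
      by (subst (2) m(1)) (simp add: power_mult_distrib power_mult)
    finally show ?thesis by simp
  qed (use one in auto)
qed

text \<open>
  Monsky's argument: if \<open>L(1,\<chi>) = 0\<close>, the Lambert series \<open>\<Sum>n. \<chi> n * t ^ n / (1 - t ^ n)\<close> may be replaced by
  minus \<open>\<Sum>n. \<chi> n * lambert_diff t n\<close>, whose weights decrease from \<open>1\<close>; so it stays bounded as \<open>t \<rightarrow> 1\<close>.
  But its power series coefficients \<open>\<Sum>d | d dvd n. \<chi> d\<close> are nonnegative, and at least \<open>1\<close> at squares.
\<close>

definition lambert_diff :: "real \<Rightarrow> nat \<Rightarrow> real" where
  "lambert_diff t n = 1 / (n * (1 - t)) - t ^ n / (1 - t ^ n)"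

text \<open>The terms i and n - 1 - i are paired; by the inequality of arithmetic and geometric
  means each pair is at least 2 * s ^ (n - 1).\<close>

lemma geometric_sum_ge:
  fixes s :: real
  shows "n * s ^ (n - 1) \<le> (\<Sum>i<n. (s\<^sup>2) ^ i)"
proof -
  have "2 * (\<Sum>i<n. (s\<^sup>2) ^ i) = (\<Sum>i<n. (s ^ i)\<^sup>2) + (\<Sum>i<n. (s ^ (n - Suc i))\<^sup>2)"
    by (subst sum.nat_diff_reindex[where g = "\<lambda>i. (s ^ i)\<^sup>2"]) (simp add: power_mult[symmetric] mult.commute)
  also have "\<dots> = (\<Sum>i<n. (s ^ i)\<^sup>2 + (s ^ (n - Suc i))\<^sup>2)" by (simp add: sum.distrib)
  also have "\<dots> \<ge> (\<Sum>i<n. 2 * s ^ (n - 1))"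
  proof (intro sum_mono)
    fix i assume "i \<in> {..<n}"
    hence "s ^ (n - 1) = s ^ i * s ^ (n - Suc i)" by (simp add: power_add[symmetric])
    thus "2 * s ^ (n - 1) \<le> (s ^ i)\<^sup>2 + (s ^ (n - Suc i))\<^sup>2"
      using sum_squares_bound[of "s ^ i" "s ^ (n - Suc i)"] by simp
  qed
  finally show ?thesis by simp
qed

text \<open>With G n = (1 - t ^ n) / (1 - t), the claim reduces to n * (n + 1) * t ^ n \<le> G n * G
  (n + 1). This follows from \<open>geometric_sum_ge\<close> at s = sqrt t.\<close>

lemma lambert_diff_Suc_le:
  assumes t: "0 < t" "t < 1" and n: "n > 0"
  shows "lambert_diff t (Suc n) \<le> lambert_diff t n"
proof -
  define G where "G = (\<lambda>n. \<Sum>i<n. t ^ i)"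
  define s where "s = sqrt t"
  have s: "s\<^sup>2 = t" "0 < s" "s < 1" using t by (auto simp: s_def)
  have G: "1 - t ^ k = (1 - t) * G k" for k by (simp add: G_def one_diff_power_eq)
  have Gpos: "G k > 0" if "k > 0" for k using that t by (auto simp: G_def intro!: sum_pos)
  have Gge: "k * s ^ (k - 1) \<le> G k" for k
    using geometric_sum_ge[of k s] s by (simp add: G_def)
  have "real n * real (Suc n) * t ^ n = (n * s ^ n) * (Suc n * s ^ n)"
    using s(1) by (simp add: power_mult[symmetric] power_add[symmetric] mult_2 flip: s(1))
  also have "\<dots> \<le> (n * s ^ (n - 1)) * (Suc n * s ^ (Suc n - 1))"
    using s by (intro mult_mono mult_left_mono power_decreasing) auto
  also have "\<dots> \<le> G n * G (Suc n)"
    using s Gpos n by (intro mult_mono Gge) (auto intro: less_imp_le)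
  finally have le: "real n * real (Suc n) * t ^ n \<le> G n * G (Suc n)" .
  have "lambert_diff t n - lambert_diff t (Suc n)
      = (1 / (1 - t)) * ((1 / n - 1 / Suc n) - (t ^ n / G n - t ^ Suc n / G (Suc n)))"
    using t n Gpos[of n] Gpos[of "Suc n"] unfolding lambert_diff_def G
    by (simp add: divide_simps) (simp add: algebra_simps)
  also have "1 / n - 1 / Suc n = 1 / (real n * real (Suc n))"
    using n by (simp add: divide_simps)
  also have "t ^ n / G n - t ^ Suc n / G (Suc n) = t ^ n * (G (Suc n) - t * G n) / (G n * G (Suc n))"
    using Gpos[of n] Gpos[of "Suc n"] n by (simp add: divide_simps) (simp add: algebra_simps)
  also have "G (Suc n) - t * G n = 1"
    unfolding G_def sum.lessThan_Suc_shift by (simp add: sum_distrib_left)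
  also have "t ^ n * 1 / (G n * G (Suc n)) \<le> 1 / (real n * real (Suc n))"
    using le Gpos[of n] Gpos[of "Suc n"] n by (simp add: divide_simps mult.commute)
  hence "(1 / (1 - t)) * (1 / (real n * real (Suc n)) - t ^ n * 1 / (G n * G (Suc n))) \<ge> 0"
    using t by (intro mult_nonneg_nonneg) auto
  finally show ?thesis by simp
qed

lemma lambert_diff_nonneg:
  assumes t: "0 < t" "t < 1" and n: "n > 0"
  shows "0 \<le> lambert_diff t n"
proof -
  have "real n * t ^ n = (\<Sum>i<n. t ^ n)" by simp
  also have "\<dots> \<le> (\<Sum>i<n. t ^ i)" using t by (intro sum_mono power_decreasing) auto
  finally have "(1 - t) * (real n * t ^ n) \<le> 1 - t ^ n"
    unfolding one_diff_power_eq using t by (intro mult_left_mono) auto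
  moreover have "t ^ n < 1" using t n by (simp add: power_less_one_iff)
  ultimately have "t ^ n / (1 - t ^ n) \<le> 1 / (n * (1 - t))"
    using t n by (intro mult_imp_div_pos_le mult_imp_le_div_pos) (auto simp: mult_ac)
  thus ?thesis by (simp add: lambert_diff_def)
qed

lemma lambert_diff_antimono:
  assumes t: "0 < t" "t < 1" and "m \<ge> 1" "m \<le> n"
  shows "lambert_diff t n \<le> lambert_diff t m"
  using assms(4,3)
  by (induction n rule: dec_induct) (auto intro: order_trans[OF lambert_diff_Suc_le] t)

section \<open>Real and nonreal characters\<close>

context nonprincipal_character
begin

lemma L_nonzero_real:
  assumes real: "\<And>n. coprime n q \<Longrightarrow> \<chi> n = 1 \<or> \<chi> n = -1"
  shows "L \<noteq> 0"
proof
  assume L0: "L = 0"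
  define f where "f = (\<lambda>n. Re (\<chi> n))"
  define r where "r = (\<lambda>n. \<Sum>d | d dvd n. f d)"
  have chi: "\<chi> n = 0 \<or> \<chi> n = 1 \<or> \<chi> n = -1" for n using real[of n] nonzero_iff[of n] by auto
  have f: "f (a * b) = f a * f b" "f 1 = 1" "f n \<in> {-1,0,1}" for a b n
    using chi[of a] chi[of b] chi[of n] by (auto simp: f_def mult)
  have r: "n > 0 \<Longrightarrow> 0 \<le> r n" "n > 0 \<Longrightarrow> 1 \<le> r (n ^ 2)" for n
    unfolding r_def by (rule sum_divisors_sign_nonneg sum_divisors_sign_square; use f in blast)+
  have fS: "norm (\<Sum>n<N. f n) \<le> q" for N
    using norm_partial_sum_le[of N] abs_Re_le_cmod[of "\<Sum>n<N. \<chi> n"] by (simp add: f_def)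
  \<comment> \<open>The Lambert series is truncated at M: the first term vanishes in the limit
    because L = 0, the middle one is Abel summation against \<open>lambert_diff\<close>, and the
    last bounds the truncation errors.\<close>
  have upper: "(\<Sum>n=1..M. r n * t ^ n) \<le> norm (S M) / (1 - t) + 2 * real q + M * t ^ M / (1 - t)"
    if t: "0 < t" "t < 1" for t M
  proof -
    have tn: "t ^ n < 1" "1 - t \<le> 1 - t ^ n" if "n > 0" for n
      using that t by (auto simp: power_less_one_iff intro: power_le_one_iff order_trans[OF power_decreasing[of 1]])
    \<comment> \<open>The tail of the n-th geometric series, beyond exponent M.\<close>
    define E where "E = (\<lambda>n. f n * (t ^ (n * (M div n + 1)) / (1 - t ^ n)))"
    have "(\<Sum>n=1..M. r n * t ^ n) = (\<Sum>n=1..M. \<Sum>d | d dvd n. f d * t ^ (d * (n div d)))"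
      by (simp add: r_def sum_distrib_right)
    also have "\<dots> = (\<Sum>d=1..M. \<Sum>m=1..M div d. f d * t ^ (d * m))"
      by (rule sum_divisors_swap)
    also have "\<dots> = (\<Sum>n=1..M. f n / (n * (1 - t)) - f n * lambert_diff t n - E n)"
    proof (intro sum.cong refl)
      fix n assume "n \<in> {1..M}"
      hence n: "n > 0" by simp
      have "(1 - t ^ n) * (\<Sum>m=1..K. (t ^ n) ^ m) = t ^ n - t ^ (n * (K + 1))" for K
        using sum_gp_multiplied[of 1 K "t ^ n"] by (cases "K = 0") (auto simp: power_mult power_add)
      hence "(\<Sum>m=1..K. (t ^ n) ^ m) = t ^ n / (1 - t ^ n) - t ^ (n * (K + 1)) / (1 - t ^ n)" for K
        using tn(1)[OF n] by (simp add: diff_divide_distrib[symmetric] eq_divide_eq mult.commute)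
      hence "f n * (\<Sum>m=1..M div n. (t ^ n) ^ m) = f n * (t ^ n / (1 - t ^ n)) - E n"
        by (simp only: E_def right_diff_distrib)
      thus "(\<Sum>m=1..M div n. f n * t ^ (n * m)) = f n / (n * (1 - t)) - f n * lambert_diff t n - E n"
        by (simp add: lambert_diff_def sum_distrib_left power_mult right_diff_distrib)
    qed
    also have "\<dots> = (\<Sum>n=1..M. f n / n) / (1 - t) - (\<Sum>n=1..M. f n * lambert_diff t n) - (\<Sum>n=1..M. E n)"
      by (simp add: sum_subtractf sum_divide_distrib)
    also have "\<dots> \<le> norm (S M) / (1 - t) + 2 * real q * 1 + M * t ^ M / (1 - t)"
    proof -
      have "(\<Sum>n=1..M. f n / n) = Re (S M)" by (simp add: S_def f_def)
      hence "(\<Sum>n=1..M. f n / n) / (1 - t) \<le> norm (S M) / (1 - t)"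
        using t complex_Re_le_cmod[of "S M"] by (intro divide_right_mono) auto
      moreover have "norm (\<Sum>n=1..<Suc M. lambert_diff t n *\<^sub>R f n) \<le> 2 * real q * lambert_diff t 1"
        by (intro Abel_bound fS lambert_diff_antimono lambert_diff_nonneg t) auto
      hence "- (\<Sum>n=1..M. f n * lambert_diff t n) \<le> 2 * real q * lambert_diff t 1"
        by (simp add: atLeastLessThanSuc_atLeastAtMost mult.commute)
      moreover have "lambert_diff t 1 = 1" using t by (simp add: lambert_diff_def field_simps)
      moreover have "- (\<Sum>n=1..M. E n) \<le> (\<Sum>n=1..M. t ^ M / (1 - t))"
        unfolding sum_negf[symmetric]
      proof (intro sum_mono)
        fix n assume "n \<in> {1..M}"
        hence n: "n > 0" by simp
        have "M \<le> n * (M div n + 1)"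
          using n by (metis dividend_less_div_times less_imp_le mult.commute mult_Suc_right Suc_eq_plus1)
        hence "t ^ (n * (M div n + 1)) / (1 - t ^ n) \<le> t ^ M / (1 - t)"
          using t tn[OF n] by (intro frac_le power_decreasing) auto
        moreover have "0 \<le> t ^ (n * (M div n + 1)) / (1 - t ^ n)"
          using t tn[OF n] by (intro divide_nonneg_nonneg) auto
        ultimately show "- E n \<le> t ^ M / (1 - t)"
          using f(3)[of n] unfolding E_def by auto
      qed
      ultimately show ?thesis by simp
    qed
    finally show ?thesis by simp
  qed
  \<comment> \<open>For fixed t let M tend to infinity; each of the R squares up to R ^ 2
    contributes at least t ^ (R ^ 2) to the left side of \<open>upper\<close>.\<close>
  have bound: "R * t ^ (R ^ 2) \<le> 2 * real q" if t: "0 < t" "t < 1" for t :: real and R :: nat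
  proof (rule tendsto_lowerbound)
    have "(\<lambda>M. norm (S M) / (1 - t) + 2 * real q + real M * t ^ M / (1 - t)) \<longlonglongrightarrow> norm L / (1 - t) + 2 * real q + 0 / (1 - t)"
      using t by (intro tendsto_intros S_tendsto powser_times_n_limit_0) auto
    thus "(\<lambda>M. norm (S M) / (1 - t) + 2 * real q + real M * t ^ M / (1 - t)) \<longlonglongrightarrow> 2 * real q"
      using L0 by simp
    have "R * t ^ (R ^ 2) \<le> norm (S M) / (1 - t) + 2 * real q + real M * t ^ M / (1 - t)" if "M \<ge> R ^ 2" for M
    proof -
      have "R * t ^ (R ^ 2) = (\<Sum>k=1..R. t ^ (R ^ 2))" by simp
      also have "\<dots> \<le> (\<Sum>k=1..R. r (k ^ 2) * t ^ (k ^ 2))"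
      proof (intro sum_mono)
        fix k assume k: "k \<in> {1..R}"
        have "1 * t ^ (R ^ 2) \<le> r (k ^ 2) * t ^ (k ^ 2)"
          using k t r(2)[of k] by (intro mult_mono power_decreasing power_mono) auto
        thus "t ^ (R ^ 2) \<le> r (k ^ 2) * t ^ (k ^ 2)" by simp
      qed
      also have "\<dots> = (\<Sum>n\<in>(\<lambda>k. k ^ 2) ` {1..R}. r n * t ^ n)"
        by (subst sum.reindex) (auto intro!: inj_onI)
      also have "\<dots> \<le> (\<Sum>n=1..M. r n * t ^ n)"
      proof (intro sum_mono2 subsetI)
        fix n assume "n \<in> (\<lambda>k. k ^ 2) ` {1..R}"
        then obtain k where "n = k ^ 2" "k \<ge> 1" "k \<le> R" by auto
        moreover from this have "k ^ 2 \<le> M"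
          by (intro order_trans[OF power_mono \<open>M \<ge> R ^ 2\<close>]) auto
        ultimately show "n \<in> {1..M}" by auto
      qed (use t r(1) in auto)
      also note upper[OF t, of M]
      finally show ?thesis .
    qed
    thus "\<forall>\<^sub>F M in sequentially. R * t ^ (R ^ 2) \<le> norm (S M) / (1 - t) + 2 * real q + real M * t ^ M / (1 - t)"
      by (auto simp: eventually_sequentially)
  qed auto
  \<comment> \<open>R = 2 * q + 1 is chosen so that t \<rightarrow> 1 gives 2 * q + 1 \<le> 2 *
    q.\<close>
  have "\<forall>\<^sub>F t in at_left (1::real). real (2 * q + 1) * t ^ ((2 * q + 1) ^ 2) \<le> 2 * real q"
  proof (rule eventually_mono)
    show "\<forall>\<^sub>F t in at_left (1::real). t \<in> {0<..<1}" by (rule eventually_at_left_real) simp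
  qed (rule bound, auto)
  moreover have "((\<lambda>t::real. real (2 * q + 1) * t ^ ((2 * q + 1) ^ 2)) \<longlongrightarrow> real (2 * q + 1) * 1 ^ ((2 * q + 1) ^ 2)) (at_left 1)"
    by (intro tendsto_intros)
  ultimately have "real (2 * q + 1) * 1 ^ ((2 * q + 1) ^ 2) \<le> 2 * real q"
    by (intro tendsto_upperbound) auto
  thus False by simp
qed

text \<open>The square of \<chi> is again nonprincipal, so the real part of its Mertens sum is
  bounded above. If L = 0, the nonnegative trigonometric combination gives 0 \<le> 3 ln N - 4 ln N +
  O(1).\<close>

lemma L_nonzero_complex:
  assumes "coprime a q" "(\<chi> a)\<^sup>2 \<noteq> 1"
  shows "L \<noteq> 0"
proof
  assume L0: "L = 0"
  interpret sq: nonprincipal_character q "\<lambda>n. (\<chi> n)\<^sup>2"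
  proof
    show "\<exists>a. coprime a q \<and> (\<chi> a)\<^sup>2 \<noteq> 1" using assms by blast
  qed (use q_pos nonzero_iff in \<open>auto simp: mult periodic power_mult_distrib\<close>)
  \<comment> \<open>An upper bound is available in both cases: if \<open>sq.L = 0\<close>, the sum
    is - ln N + O(1).\<close>
  obtain C where C: "Re (sq.V N) \<le> C" if "N > 0" for N
  proof (cases "sq.L = 0")
    case True
    have "Re (sq.V N) \<le> 2 * real q" if "N > 0" for N
    proof -
      have "Re (sq.V N) + ln N = Re (sq.V N + of_real (ln N))" by simp
      also have "\<dots> \<le> 2 * real q"
        using sq.bounded_if_L_zero[OF True that] complex_Re_le_cmod order_trans by blast
      finally show ?thesis using that by (smt (verit) ln_ge_zero of_nat_1 of_nat_le_iff Suc_leI One_nat_def)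
    qed
    thus ?thesis using that by blast
  next
    case False
    from sq.bounded_if_L_nonzero[OF this] obtain C where "\<And>N. norm (sq.V N) \<le> C" by auto
    hence "\<And>N. Re (sq.V N) \<le> C" using complex_Re_le_cmod order_trans by blast
    thus ?thesis using that by blast
  qed
  \<comment> \<open>12 is 3 times the 4 of \<open>mertens_upper\<close>, and 8 * q is 4 times the
    bound of \<open>bounded_if_L_zero\<close>.\<close>
  have "ln (real N) \<le> 12 + 8 * real q + C" if N: "N > 0" for N
  proof -
    have "0 \<le> (\<Sum>n=1..N. (3 * (norm (\<chi> n))\<^sup>2 + 4 * Re (\<chi> n) + Re ((\<chi> n)\<^sup>2)) * (\<Lambda> n / n))"
    proof (intro sum_nonneg mult_nonneg_nonneg divide_nonneg_nonneg mangoldt_nonneg)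
      fix n
      show "0 \<le> 3 * (norm (\<chi> n))\<^sup>2 + 4 * Re (\<chi> n) + Re ((\<chi> n)\<^sup>2)"
      proof (cases "coprime n q")
        case True
        hence "norm (\<chi> n) = 1" by (rule norm_eq_1)
        moreover from this have "(Re (\<chi> n))\<^sup>2 + (Im (\<chi> n))\<^sup>2 = 1" by (simp add: cmod_def)
        hence "Re ((\<chi> n)\<^sup>2) = 2 * (Re (\<chi> n))\<^sup>2 - 1" by (simp add: power2_eq_square)
        ultimately have "3 * (norm (\<chi> n))\<^sup>2 + 4 * Re (\<chi> n) + Re ((\<chi> n)\<^sup>2) = 2 * (1 + Re (\<chi> n))\<^sup>2"
          by (simp add: power2_eq_square algebra_simps)
        thus ?thesis by simp
      next
        case False
        hence "\<chi> n = 0" using nonzero_iff by blast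
        thus ?thesis by simp
      qed
    qed auto
    also have "\<dots> = 3 * (\<Sum>n=1..N. (norm (\<chi> n))\<^sup>2 * (\<Lambda> n / n)) + 4 * Re (V N) + Re (sq.V N)"
      by (simp add: V_def sq.V_def sum.distrib sum_distrib_left algebra_simps)
    also have "(\<Sum>n=1..N. (norm (\<chi> n))\<^sup>2 * (\<Lambda> n / n)) \<le> (\<Sum>n=1..N. 1 * (\<Lambda> n / n))"
      using norm_le_1 by (intro sum_mono mult_right_mono) (auto simp: mangoldt_nonneg power_le_one)
    also have "\<dots> \<le> ln N + 4" using mertens_upper[OF N] by simp
    finally have "0 \<le> 3 * (ln N + 4) + 4 * Re (V N) + C" using C[OF N] by simp
    moreover have "Re (V N) + ln N \<le> 2 * real q"
      using bounded_if_L_zero[OF L0 N] complex_Re_le_cmod[of "V N + ln N"] by simp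
    ultimately show ?thesis by simp
  qed
  from this[of "nat \<lceil>exp (13 + 8 * real q + C)\<rceil>"]
  have "ln (real (nat \<lceil>exp (13 + 8 * real q + C)\<rceil>)) \<le> 12 + 8 * real q + C" by simp
  moreover have "ln (exp (13 + 8 * real q + C)) \<le> ln (real (nat \<lceil>exp (13 + 8 * real q + C)\<rceil>))"
    by (intro ln_mono) (auto intro: real_nat_ceiling_ge)
  ultimately show False by simp
qed

lemma L_nonzero: "L \<noteq> 0"
proof (cases "\<exists>a. coprime a q \<and> (\<chi> a)\<^sup>2 \<noteq> 1")
  case True
  thus ?thesis using L_nonzero_complex by blast
next
  case False
  thus ?thesis by (intro L_nonzero_real) (auto simp: power2_eq_1_iff)
qed

end

text \<open>The excluded n with \<Lambda> n \<noteq> 0 are powers of the finitely many primes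
  dividing q and contribute O(1). This is the case of the principal character.\<close>

lemma mertens_coprime:
  assumes "q > 0"
  shows "\<exists>C. \<forall>N::nat. N > 0 \<longrightarrow> \<bar>(\<Sum>n\<in>{n\<in>{1..N}. coprime n q}. \<Lambda> n / n) - ln N\<bar> \<le> C"
proof -
  define B where "B = (\<Sum>p\<in>prime_factors q. 2 * ln (real p) / real p ^ 1)"
  have "\<bar>(\<Sum>n\<in>{n\<in>{1..N}. coprime n q}. \<Lambda> n / n) - ln N\<bar> \<le> 4 + B" if N: "N > 0" for N :: nat
  proof -
    have "(\<Sum>n\<in>{n\<in>{1..N}. \<not> coprime n q}. \<Lambda> n / n) \<le> B"
      unfolding B_def
    proof (intro sum_mangoldt_prime_powers_le)
      fix n assume n: "n \<in> {n\<in>{1..N}. \<not> coprime n q}" "primepow n"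
      then obtain p k where pk: "prime p" "k > 0" "n = p ^ k" by (auto simp: primepow_def)
      hence "p dvd q" using n(1) prime_imp_coprime[of p q] by auto
      thus "\<exists>p\<in>prime_factors q. \<exists>k\<ge>1. n = p ^ k" using pk assms by (auto simp: in_prime_factors_iff Suc_le_eq)
    qed auto
    moreover have "(\<Sum>n=1..N. \<Lambda> n / n) = (\<Sum>n\<in>{n\<in>{1..N}. coprime n q}. \<Lambda> n / n) + (\<Sum>n\<in>{n\<in>{1..N}. \<not> coprime n q}. \<Lambda> n / n)"
      by (subst sum.union_disjoint[symmetric]) (auto intro!: sum.cong)
    moreover have "0 \<le> (\<Sum>n\<in>{n\<in>{1..N}. \<not> coprime n q}. \<Lambda> n / n)"
      by (intro sum_nonneg) (auto simp: mangoldt_nonneg)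
    ultimately show ?thesis
      using mertens_upper[OF N] mertens_lower[OF N] by (simp only: abs_le_iff) linarith
  qed
  thus ?thesis by (intro exI allI impI)
qed

section \<open>Primes in arithmetic progressions\<close>

text \<open>The functions on the unit group modulo q, extended by 0 and lifted to the natural
  numbers.\<close>

definition residue_function :: "nat \<Rightarrow> (nat \<Rightarrow> complex) \<Rightarrow> bool" where
  "residue_function q f \<longleftrightarrow> (\<forall>n. f (n + q) = f n) \<and> (\<forall>n. \<not> coprime n q \<longrightarrow> f n = 0)"

lemma residue_function_cong:
  assumes "residue_function q f" "[m = n] (mod q)"
  shows "f m = f n"
proof -
  have "f (a + k * q) = f a" for a k
  proof (induction k)
    case (Suc k)
    thus ?case using assms(1) by (metis residue_function_def mult_Suc add.assoc add.commute)
  qed simp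
  from this[of "m mod q" "m div q"] this[of "n mod q" "n div q"] assms(2)
  show ?thesis by (simp add: cong_def)
qed

definition units_below :: "nat \<Rightarrow> nat set" where
  "units_below q = {r. r < q \<and> coprime r q}"

text \<open>For f vanishing off the units, the coefficient of ln N is the mean of f over the units.
  The property is linear in f, which permits the reduction to characters.\<close>

definition mertens_mean :: "nat \<Rightarrow> (nat \<Rightarrow> complex) \<Rightarrow> bool" where
  "mertens_mean q f \<longleftrightarrow> (\<exists>C. \<forall>N::nat. N > 0 \<longrightarrow> norm ((\<Sum>n=1..N. f n * of_real (\<Lambda> n) / of_nat n)
      - (\<Sum>r<q. f r) / of_nat (card (units_below q)) * of_real (ln N)) \<le> C)"

lemma mertens_mean_add:
  assumes "mertens_mean q f" "mertens_mean q g"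
  shows "mertens_mean q (\<lambda>n. f n + g n)"
proof -
  obtain C D where C: "\<And>N. N > 0 \<Longrightarrow> norm ((\<Sum>n=1..N. f n * of_real (\<Lambda> n) / of_nat n)
      - (\<Sum>r<q. f r) / of_nat (card (units_below q)) * of_real (ln N)) \<le> C"
    and D: "\<And>N. N > 0 \<Longrightarrow> norm ((\<Sum>n=1..N. g n * of_real (\<Lambda> n) / of_nat n)
      - (\<Sum>r<q. g r) / of_nat (card (units_below q)) * of_real (ln N)) \<le> D"
    using assms unfolding mertens_mean_def by blast
  show ?thesis unfolding mertens_mean_def
  proof (intro exI allI impI)
    fix N :: nat assume "N > 0"
    from norm_triangle_mono[OF C[OF this] D[OF this]]
    show "norm ((\<Sum>n=1..N. (f n + g n) * of_real (\<Lambda> n) / of_nat n)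
      - (\<Sum>r<q. f r + g r) / of_nat (card (units_below q)) * of_real (ln N)) \<le> C + D"
      by (simp add: sum.distrib add_divide_distrib algebra_simps)
  qed
qed

lemma mertens_mean_scale:
  assumes "mertens_mean q f"
  shows "mertens_mean q (\<lambda>n. c * f n)"
proof -
  obtain C where C: "\<And>N. N > 0 \<Longrightarrow> norm ((\<Sum>n=1..N. f n * of_real (\<Lambda> n) / of_nat n)
      - (\<Sum>r<q. f r) / of_nat (card (units_below q)) * of_real (ln N)) \<le> C"
    using assms unfolding mertens_mean_def by blast
  show ?thesis unfolding mertens_mean_def
  proof (intro exI allI impI)
    fix N :: nat assume "N > 0"
    have "(\<Sum>n=1..N. c * f n * of_real (\<Lambda> n) / of_nat n) - (\<Sum>r<q. c * f r) / of_nat (card (units_below q)) * of_real (ln N)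
        = c * ((\<Sum>n=1..N. f n * of_real (\<Lambda> n) / of_nat n) - (\<Sum>r<q. f r) / of_nat (card (units_below q)) * of_real (ln N))"
      by (simp add: sum_distrib_left[symmetric] right_diff_distrib mult.assoc flip: times_divide_eq_right)
    also have "norm \<dots> \<le> norm c * C"
      unfolding norm_mult using C[OF \<open>N > 0\<close>] by (intro mult_left_mono) auto
    finally show "norm ((\<Sum>n=1..N. c * f n * of_real (\<Lambda> n) / of_nat n) - (\<Sum>r<q. c * f r) / of_nat (card (units_below q)) * of_real (ln N))
      \<le> norm c * C" .
  qed
qed

lemma mertens_mean_sum:
  assumes "finite I" "\<And>i. i \<in> I \<Longrightarrow> mertens_mean q (f i)"
  shows "mertens_mean q (\<lambda>n. \<Sum>i\<in>I. f i n)"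
  using assms
proof (induction I)
  case empty
  show ?case by (auto simp: mertens_mean_def)
next
  case (insert i I)
  thus ?case by (simp add: mertens_mean_add)
qed

lemma (in residue_character) mertens_mean_character: "mertens_mean q \<chi>"
proof (cases "\<exists>a. coprime a q \<and> \<chi> a \<noteq> 1")
  case True
  then interpret nonprincipal_character q \<chi> by unfold_locales
  show ?thesis
    using bounded_if_L_nonzero[OF L_nonzero] unfolding mertens_mean_def sum_period V_def by auto
next
  case False
  hence chi: "\<chi> n = (if coprime n q then 1 else 0)" for n using nonzero_iff[of n] by auto
  obtain C where C: "\<forall>N::nat. N > 0 \<longrightarrow> \<bar>(\<Sum>n\<in>{n\<in>{1..N}. coprime n q}. \<Lambda> n / n) - ln N\<bar> \<le> C"
    using mertens_coprime[OF q_pos] by (elim exE)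
  have "(\<Sum>r<q. \<chi> r) = (\<Sum>r\<in>units_below q. 1)"
    by (intro sum.mono_neutral_cong_right) (auto simp: units_below_def chi)
  \<comment> \<open>\<open>1 mod q\<close> and not \<open>1\<close>: for q = 1 the only unit below q
    is 0.\<close>
  moreover have "1 mod q \<in> units_below q" using q_pos by (auto simp: units_below_def)
  hence "card (units_below q) > 0" by (auto simp: card_gt_0_iff units_below_def)
  moreover have "(\<Sum>n=1..N. \<chi> n * of_real (\<Lambda> n) / of_nat n) = of_real (\<Sum>n\<in>{n\<in>{1..N}. coprime n q}. \<Lambda> n / n)" for N
    unfolding of_real_sum by (intro sum.mono_neutral_cong_right) (auto simp: chi)
  ultimately have "(\<Sum>n=1..N. \<chi> n * of_real (\<Lambda> n) / of_nat n) - (\<Sum>r<q. \<chi> r) / of_nat (card (units_below q)) * of_real (ln N)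
     = of_real ((\<Sum>n\<in>{n\<in>{1..N}. coprime n q}. \<Lambda> n / n) - ln N)" for N by simp
  thus ?thesis
    unfolding mertens_mean_def using C by (simp only: norm_of_real) (rule exI)
qed

section \<open>Decomposition into joint eigenfunctions\<close>

definition eigenfunction :: "(nat \<Rightarrow> complex) \<Rightarrow> nat \<Rightarrow> bool" where
  "eigenfunction f g \<longleftrightarrow> (\<exists>c. \<forall>n. f (g * n) = c * f n)"

text \<open>Evaluation at 1 identifies the eigenvalue of g as f g / f 1, so f / f 1 is a character;
  if f 1 = 0, then f vanishes identically.\<close>

lemma mertens_mean_joint_eigenfunction:
  assumes q: "q > 0" and f: "residue_function q f" and eigen: "\<forall>g\<in>units_below q. eigenfunction f g"
  shows "mertens_mean q f"
proof -
  obtain c where c: "f (g * n) = c g * f n" if "coprime g q" for g n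
  proof -
    have "\<exists>c. \<forall>n. f (g * n) = c * f n" if "coprime g q" for g
    proof -
      have "g mod q \<in> units_below q" using that q by (simp add: units_below_def)
      then obtain c where "\<And>n. f (g mod q * n) = c * f n" using eigen unfolding eigenfunction_def by blast
      moreover have "f (g mod q * n) = f (g * n)" for n
        by (rule residue_function_cong[OF f]) (simp add: cong_def mod_mult_left_eq)
      ultimately show ?thesis by auto
    qed
    thus ?thesis using that by metis
  qed
  have f0: "f n = 0" if "\<not> coprime n q" for n using f that by (auto simp: residue_function_def)
  have f1: "f n = c n * f 1" if "coprime n q" for n using c[OF that, of 1] by simp
  show ?thesis
  proof (cases "f 1 = 0")
    case True
    hence "f n = 0" for n using f0[of n] f1[of n] by (metis mult_zero_right)
    thus ?thesis by (auto simp: mertens_mean_def)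
  next
    case False
    interpret residue_character q "\<lambda>n. f n / f 1"
    proof
      show "f (m * n) / f 1 = f m / f 1 * (f n / f 1)" for m n
      proof (cases "coprime m q")
        case True
        thus ?thesis using c[of m n] f1[of m] False by simp
      next
        case False
        thus ?thesis using f0[of m] f0[of "m * n"] by simp
      qed
      show "f (n + q) / f 1 = f n / f 1" for n using f by (simp add: residue_function_def)
      show "f n / f 1 \<noteq> 0 \<longleftrightarrow> coprime n q" for n
      proof
        assume n: "coprime n q"
        then obtain m where "[n * m = 1] (mod q)" using cong_solve_coprime_nat by auto
        hence "f (n * m) = f 1" by (rule residue_function_cong[OF f])
        hence "c n * f m = f 1" using c[OF n] by simp
        thus "f n / f 1 \<noteq> 0" using f1[OF n] False by (metis divide_eq_0_iff mult_eq_0_iff)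
      qed (use f0 in auto)
    qed (rule q)
    show ?thesis using mertens_mean_scale[OF mertens_mean_character, of "f 1"] False by simp
  qed
qed

definition unity_root :: "nat \<Rightarrow> nat \<Rightarrow> complex" where
  "unity_root m j = cis (2 * pi * real j / real m)"

lemma unity_root_power:
  assumes "m > 0"
  shows "unity_root m j ^ m = 1"
  using assms cis_multiple_2pi[of "real j"] by (simp add: unity_root_def DeMoivre)

text \<open>Exchanging j and k makes this a geometric sum whose ratio is an m-th root of unity other
  than 1 for k \<noteq> 0.\<close>

lemma sum_unity_root:
  assumes "k < m"
  shows "(\<Sum>j<m. unity_root m j ^ k) = (if k = 0 then of_nat m else 0)"
proof (cases "k = 0")
  case False
  have m: "m > 0" using assms by simp
  have "unity_root m k \<noteq> unity_root m 0"
  proof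
    assume "unity_root m k = unity_root m 0"
    moreover have "inj_on (\<lambda>k. cis (2 * pi * real k / real m)) {..<m}"
      using bij_betw_roots_unity[OF m] by (simp add: bij_betw_def)
    ultimately show False using False assms by (auto simp: unity_root_def inj_on_def)
  qed
  hence ne: "unity_root m k \<noteq> 1" by (simp add: unity_root_def)
  have "(1 - unity_root m k) * (\<Sum>j<m. unity_root m k ^ j) = 1 - unity_root m k ^ m"
    by (rule one_diff_power_eq[symmetric])
  hence "(\<Sum>j<m. unity_root m k ^ j) = 0" using ne m by (simp add: unity_root_power)
  moreover have "unity_root m k ^ j = unity_root m j ^ k" for j
    by (simp add: unity_root_def DeMoivre mult_ac)
  ultimately show ?thesis using False by simp
qed simp

text \<open>
  Since \<open>g ^ totient q\<close> is \<open>1\<close> modulo \<open>q\<close>, averaging against the powers of a root of unity projects \<open>f\<close> onto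
  an eigenspace of \<open>g\<close>, and it preserves the eigenspaces of all the other units.
\<close>

lemma mertens_mean_partial_eigenfunction:
  assumes q: "q > 0" and D: "finite D" "D \<subseteq> units_below q"
    and f: "residue_function q f" and eigen: "\<forall>g\<in>units_below q - D. eigenfunction f g"
  shows "mertens_mean q f"
  using D f eigen
proof (induction D arbitrary: f rule: finite_induct)
  case empty
  thus ?case using mertens_mean_joint_eigenfunction[OF q] by simp
next
  case (insert g D)
  define m where "m = totient q"
  have m: "m > 0" using q by (simp add: m_def)
  define P where "P = (\<lambda>j n. (1 / of_nat m) * (\<Sum>k<m. unity_root m j ^ k * f (g ^ k * n)))"
  have g: "coprime g q" using insert.prems by (auto simp: units_below_def)
  have f_cong: "f a = f b" if "[a = b] (mod q)" for a b
    using residue_function_cong[OF insert.prems(2) that] .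
  have "mertens_mean q (P j)" for j
  proof (rule insert.IH)
    show "residue_function q (P j)"
      unfolding residue_function_def
    proof (intro conjI allI impI)
      fix n
      have "f (g ^ k * (n + q)) = f (g ^ k * n)" for k
        by (rule f_cong) (simp add: cong_def distrib_left)
      thus "P j (n + q) = P j n" by (simp add: P_def)
      assume "\<not> coprime n q"
      hence "f (g ^ k * n) = 0" for k using insert.prems(2) by (simp add: residue_function_def)
      thus "P j n = 0" by (simp add: P_def)
    qed
    show "\<forall>h\<in>units_below q - D. eigenfunction (P j) h"
    proof
      fix h assume h: "h \<in> units_below q - D"
      show "eigenfunction (P j) h"
      proof (cases "h = g")
        case False
        then obtain c where c: "\<And>n. f (h * n) = c * f n"
          using h insert.prems(3) unfolding eigenfunction_def by blast
        have "f (g ^ k * (h * n)) = c * f (g ^ k * n)" for k n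
          using c[of "g ^ k * n"] by (simp add: mult_ac)
        hence "P j (h * n) = c * P j n" for n
          unfolding P_def by (simp only: sum_distrib_left) (simp only: mult_ac)
        thus ?thesis by (auto simp: eigenfunction_def)
      next
        case True
        define w where "w = unity_root m j"
        have wm: "w ^ m = 1" using m by (simp add: w_def unity_root_power)
        have "w * P j (g * n) = P j n" for n
        proof -
          define a where "a = (\<lambda>k. w ^ k * f (g ^ k * n))"
          \<comment> \<open>The summands are periodic in k, \<open>a m = a 0\<close>, so shifting
            the index preserves the sum; hence g acts on \<open>P j\<close> by the inverse of
            w.\<close>
          have "[g ^ m * n = 1 * n] (mod q)"
            unfolding m_def by (intro cong_mult euler_theorem g cong_refl)
          hence "a m = a 0" using f_cong wm by (auto simp: a_def)
          moreover have "(\<Sum>k<m. a (Suc k)) + a 0 = (\<Sum>k<m. a k) + a m"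
            using sum.lessThan_Suc_shift[of a m] by (simp add: add.commute)
          ultimately have "(\<Sum>k<m. a (Suc k)) = (\<Sum>k<m. a k)" by simp
          moreover have "w * P j (g * n) = (1 / of_nat m) * (\<Sum>k<m. a (Suc k))"
            by (simp only: P_def a_def w_def sum_distrib_left power_Suc mult_ac)
          ultimately show ?thesis by (simp only: P_def a_def w_def)
        qed
        moreover have "w \<noteq> 0" by (simp add: w_def unity_root_def)
        ultimately have "P j (g * n) = inverse w * P j n" for n
          by (metis left_inverse mult.assoc mult_1)
        thus ?thesis using True by (auto simp: eigenfunction_def)
      qed
    qed
  qed (use insert.prems in auto)
  hence "mertens_mean q (\<lambda>n. \<Sum>j<m. P j n)" by (intro mertens_mean_sum) auto
  \<comment> \<open>Orthogonality of the roots of unity leaves only k = 0, where g ^ 0 * n =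
    n.\<close>
  also have "(\<lambda>n. \<Sum>j<m. P j n) = f"
  proof
    fix n
    have "(\<Sum>j<m. P j n) = (1 / of_nat m) * (\<Sum>k<m. \<Sum>j<m. unity_root m j ^ k * f (g ^ k * n))"
      unfolding P_def sum_distrib_left[symmetric] by (subst sum.swap) simp
    also have "(\<Sum>k<m. \<Sum>j<m. unity_root m j ^ k * f (g ^ k * n)) = (\<Sum>k<m. if k = 0 then of_nat m * f n else 0)"
      by (intro sum.cong refl) (simp add: sum_distrib_right[symmetric] sum_unity_root)
    finally show "(\<Sum>j<m. P j n) = f n" using m by simp
  qed
  finally show ?case .
qed

lemma mertens_mean_residue_function:
  assumes "q > 0" "residue_function q f"
  shows "mertens_mean q f"
  using mertens_mean_partial_eigenfunction[of q "units_below q" f] assms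
  by (simp add: units_below_def)

text \<open>The indicator of the class of a has mean 1 / K, so its Mertens sum grows like ln N / K.
  If the class had finitely many primes, they would contribute at most \<open>B\<close> and the
  proper prime powers at most 6.\<close>

theorem infinite_primes_in_progression:
  fixes a q :: nat
  assumes q: "q > 0" and a: "coprime a q"
  shows "infinite {p. prime p \<and> [p = a] (mod q)}"
proof
  define Q where "Q = {p. prime p \<and> [p = a] (mod q)}"
  assume "finite {p. prime p \<and> [p = a] (mod q)}"
  hence fin: "finite Q" by (simp add: Q_def)
  define f :: "nat \<Rightarrow> complex" where "f = (\<lambda>n. if [n = a] (mod q) then 1 else 0)"
  have "residue_function q f"
    unfolding residue_function_def
  proof (intro conjI allI impI)
    fix n
    show "f (n + q) = f n" by (simp add: f_def cong_def)
    assume "\<not> coprime n q"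
    thus "f n = 0" using a by (auto simp: f_def dest: cong_imp_coprime cong_sym)
  qed
  with q have "mertens_mean q f" by (rule mertens_mean_residue_function)
  then obtain C where C: "\<And>N. N > 0 \<Longrightarrow> norm ((\<Sum>n=1..N. f n * of_real (\<Lambda> n) / of_nat n)
      - (\<Sum>r<q. f r) / of_nat (card (units_below q)) * of_real (ln N)) \<le> C"
    unfolding mertens_mean_def by blast
  define K where "K = real (card (units_below q))"
  have "a mod q \<in> units_below q" using a q by (simp add: units_below_def)
  hence K: "K > 0" by (auto simp: K_def card_gt_0_iff units_below_def)
  have "(\<Sum>r<q. f r) = (\<Sum>r\<in>{a mod q}. 1)"
    using q by (intro sum.mono_neutral_cong_right) (auto simp: f_def cong_def)
  hence f1: "(\<Sum>r<q. f r) = 1" by simp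
  define B where "B = (\<Sum>p\<in>Q. \<Lambda> p / p)"
  have "ln N \<le> K * (C + B + 6)" if N: "N > 0" for N :: nat
  proof -
    define T where "T = {n\<in>{1..N}. [n = a] (mod q)}"
    have "(\<Sum>n=1..N. f n * of_real (\<Lambda> n) / of_nat n) = of_real (\<Sum>n\<in>T. \<Lambda> n / n)"
      unfolding of_real_sum T_def by (intro sum.mono_neutral_cong_right) (auto simp: f_def)
    hence "(\<Sum>n=1..N. f n * of_real (\<Lambda> n) / of_nat n) - (\<Sum>r<q. f r) / of_nat (card (units_below q)) * of_real (ln N)
        = of_real ((\<Sum>n\<in>T. \<Lambda> n / n) - ln N / K)"
      by (simp add: f1 K_def)
    hence "\<bar>(\<Sum>n\<in>T. \<Lambda> n / n) - ln N / K\<bar> \<le> C" using C[OF N] by (metis norm_of_real)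
    hence "ln N / K \<le> C + (\<Sum>n\<in>T. \<Lambda> n / n)" by linarith
    also have "(\<Sum>n\<in>T. \<Lambda> n / n) = (\<Sum>n\<in>{n\<in>T. prime n}. \<Lambda> n / n) + (\<Sum>n\<in>{n\<in>T. \<not> prime n}. \<Lambda> n / n)"
      by (subst sum.union_disjoint[symmetric]) (auto simp: T_def intro!: sum.cong)
    also have "(\<Sum>n\<in>{n\<in>T. prime n}. \<Lambda> n / n) \<le> B"
      unfolding B_def by (rule sum_mono2[OF fin]) (auto simp: T_def Q_def prime_gt_0_nat Suc_le_eq)
    also have "(\<Sum>n\<in>{n\<in>T. \<not> prime n}. \<Lambda> n / n) \<le> (\<Sum>p\<in>{p\<in>{1..N}. prime p}. 2 * ln (real p) / real p ^ 2)"
    proof (intro sum_mangoldt_prime_powers_le)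
      fix n assume n: "n \<in> {n\<in>T. \<not> prime n}" "primepow n"
      then obtain p k where pk: "prime p" "k > 0" "n = p ^ k" by (auto simp: primepow_def)
      moreover have "k \<ge> 2"
      proof (rule ccontr)
        assume "\<not> k \<ge> 2"
        hence "k = 1" using pk by simp
        thus False using n pk by simp
      qed
      moreover have "p \<le> N"
        using n pk self_le_power[of p k] by (auto simp: T_def prime_gt_0_nat Suc_le_eq)
      ultimately show "\<exists>p\<in>{p\<in>{1..N}. prime p}. \<exists>k\<ge>2. n = p ^ k"
        by (intro bexI[of _ p] exI[of _ k]) (auto simp: prime_gt_0_nat Suc_le_eq)
    qed (auto simp: T_def)
    also have "\<dots> \<le> (\<Sum>p=1..N. 2 * ln (real p) / real p ^ 2)"
      by (intro sum_mono2) auto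
    also have "\<dots> \<le> 6" using sum_ln_over_square_le[of N] by (simp add: sum_distrib_left[symmetric] flip: times_divide_eq_right)
    finally show ?thesis using K by (simp add: field_simps)
  qed
  from this[of "nat \<lceil>exp (K * (C + B + 6) + 1)\<rceil>"]
  have "ln (real (nat \<lceil>exp (K * (C + B + 6) + 1)\<rceil>)) \<le> K * (C + B + 6)" by simp
  moreover have "ln (exp (K * (C + B + 6) + 1)) \<le> ln (real (nat \<lceil>exp (K * (C + B + 6) + 1)\<rceil>))"
    by (intro ln_mono) (auto intro: real_nat_ceiling_ge)
  ultimately show False by simp
qed

section \<open>The covering systems\<close>

text \<open>The shift \<open>s\<close> is 1 or -1 in the applications. The bound d < B + s makes d a
  proper divisor for every k in the progression.\<close>

lemma composite_cover:
  fixes A B s k :: int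
  assumes cover: "\<exists>(l,r,d)\<in>C. n mod l = r"
    and C: "\<forall>(l,r,d)\<in>C. d dvd A \<and> d dvd B * 2 ^ r + s \<and> d dvd 2 ^ l - 1 \<and> 1 < d \<and> d < B + s"
    and k: "k = A * m + B" "A * m \<ge> 0" "B \<ge> 0"
  shows "composite (k * 2 ^ n + s)"
proof -
  obtain l r d where lrd: "(l, r, d) \<in> C" "n mod l = r" using cover by auto
  hence d: "d dvd A" "d dvd B * 2 ^ r + s" "d dvd 2 ^ l - 1" "1 < d" "d < B + s" using C by auto
  have "[k * 2 ^ n = B * 2 ^ n] (mod d)"
    using d(1) by (intro cong_mult cong_refl) (simp add: k cong_iff_dvd_diff)
  also have "B * 2 ^ n = B * ((2 ^ l) ^ (n div l) * 2 ^ r)"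
    using lrd(2) mult_div_mod_eq[of l n] by (simp flip: power_mult power_add)
  also have "[B * ((2 ^ l) ^ (n div l) * 2 ^ r) = B * (1 ^ (n div l) * 2 ^ r)] (mod d)"
    using d(3) by (intro cong_mult cong_pow cong_refl) (simp add: cong_iff_dvd_diff)
  finally have "[k * 2 ^ n + s = B * 2 ^ r + s] (mod d)"
    by (intro cong_add cong_refl) simp
  hence dvd: "d dvd k * 2 ^ n + s" using d(2) by (simp add: cong_dvd_iff)
  have "B * 1 \<le> k * 2 ^ n" using d k by (intro mult_mono) auto
  hence gt: "d < k * 2 ^ n + s" using d(5) by linarith
  hence "\<not> prime (k * 2 ^ n + s)" using dvd d(4) unfolding prime_int_iff by (metis less_imp_le less_irrefl order_trans zero_le_one)
  thus ?thesis using gt d(4) by (simp add: composite_def)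
qed

text \<open>
  A covering system is a list of stages \<open>(c, D)\<close>. Given the residues \<open>U\<close> modulo \<open>M\<close> not covered so far, a stage
  lifts them to the modulus \<open>M * c\<close> and removes those that satisfy \<open>x mod l = r\<close> for an entry \<open>(l, r, d)\<close> of
  \<open>D\<close>; this keeps the lists short. The entry \<open>d\<close> is the divisor responsible for that residue class.
\<close>

fun uncovered :: "nat \<Rightarrow> nat list \<Rightarrow> (nat \<times> (nat \<times> nat \<times> int) list) list \<Rightarrow> nat list" where
  "uncovered M U [] = U"
| "uncovered M U ((c, D) # xs) = uncovered (M * c)
     (filter (\<lambda>x. list_all (\<lambda>(l,r,d). l dvd M * c \<longrightarrow> x mod l \<noteq> r) D)
       (concat (map (\<lambda>i. map (\<lambda>u. M * i + u) U) [0..<c]))) xs"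

definition triples :: "(nat \<times> (nat \<times> nat \<times> int) list) list \<Rightarrow> (nat \<times> nat \<times> int) set" where
  "triples xs = set (concat (map snd xs))"

text \<open>If n avoids every entry, its residue survives all stages, so an empty result certifies a
  covering. The guard \<open>l dvd M * c\<close> ensures that the residue modulo M * c determines
  the one modulo l.\<close>

lemma uncovered_sound:
  assumes "n mod M \<in> set U" "\<forall>(l,r,d)\<in>triples xs. n mod l \<noteq> r" "\<forall>(c,D)\<in>set xs. c > 0"
  shows "set (uncovered M U xs) \<noteq> {}"
  using assms
proof (induction M U xs rule: uncovered.induct)
  case (2 M U c D xs)
  have "n mod (M * c) = M * (n div M mod c) + n mod M" by (simp add: mod_mult2_eq)
  moreover have "n div M mod c < c" using 2(4) by simp
  moreover have "n mod (M * c) mod l \<noteq> r" if "(l,r,d) \<in> set D" "l dvd M * c" for l r d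
  proof -
    have "(l,r,d) \<in> triples ((c, D) # xs)" using that(1) by (simp add: triples_def)
    hence "n mod l \<noteq> r" using 2(3) by fast
    thus ?thesis using that(2) by (simp add: mod_mod_cancel)
  qed
  ultimately have "n mod (M * c) \<in> set (filter (\<lambda>x. list_all (\<lambda>(l,r,d). l dvd M * c \<longrightarrow> x mod l \<noteq> r) D)
       (concat (map (\<lambda>i. map (\<lambda>u. M * i + u) U) [0..<c])))"
    using 2(2) by (fastforce simp: list_all_iff)
  thus ?case using 2 by (simp add: triples_def)
qed auto

text \<open>The divisors come from the Fermat numbers 2 ^ (2 ^ i) + 1 with i \<le> 5. Each stage
  doubles the modulus and leaves only the residue 1, until the two factors 641 and 6700417 of the
  last number cover both remaining classes.\<close>

definition sierpinski_cover :: "(nat \<times> (nat \<times> nat \<times> int) list) list" where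
  "sierpinski_cover = [(2, [(2, 0, 3)]), (2, [(4, 3, 5)]), (2, [(8, 5, 17)]), (2, [(16, 9, 257)]),
     (2, [(32, 17, 65537)]), (2, [(64, 1, 641), (64, 33, 6700417)])]"

text \<open>The moduli of the stages are 6, 30, 60, 360 and 1440. The divisor 3 is shared with the
  other cover: B = 2 modulo 3 serves even exponents there and odd exponents here.\<close>

definition riesel_cover :: "(nat \<times> (nat \<times> nat \<times> int) list) list" where
  "riesel_cover = [(6, [(2, 1, 3), (3, 0, 7)]), (5, [(5, 0, 31), (10, 2, 11), (15, 1, 151)]),
     (2, [(20, 8, 41), (30, 4, 331), (60, 14, 61), (60, 44, 1321)]),
     (6, [(40, 18, 61681), (45, 11, 631), (45, 26, 23311), (90, 86, 18837001)]),
     (4, [(80, 38, 4278255361), (160, 78, 414721), (160, 158, 44479210368001)])]"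

lemma sierpinski_cover: "\<exists>(l,r,d)\<in>triples sierpinski_cover. n mod l = r"
proof -
  have "uncovered 1 [0] sierpinski_cover = []"
    by (simp add: sierpinski_cover_def upt_rec)
  moreover have "\<forall>(c,D)\<in>set sierpinski_cover. c > 0" by (simp add: sierpinski_cover_def)
  ultimately show ?thesis using uncovered_sound[of n 1 "[0]" sierpinski_cover] by auto
qed

lemma riesel_cover: "\<exists>(l,r,d)\<in>triples riesel_cover. n mod l = r"
proof -
  have "uncovered 1 [0] riesel_cover = []"
    by (simp add: riesel_cover_def upt_rec)
  moreover have "\<forall>(c,D)\<in>set riesel_cover. c > 0" by (simp add: riesel_cover_def)
  ultimately show ?thesis using uncovered_sound[of n 1 "[0]" riesel_cover] by auto
qed

section \<open>Brier numbers and primes in the progression\<close>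

lemma brier_progression:
  fixes A B :: int
  defines "A \<equiv> 19613577555635811210751525911492599150619172808998516420233576073634048313995204010"
    and "B \<equiv> 7609973832199104332900520118697392466473343921195005927808542086911702037440072483"
  shows "brier_number (A * int m + B)"
proof -
  have "\<forall>(l,r,d)\<in>triples sierpinski_cover. d dvd A \<and> d dvd B * 2 ^ r + 1 \<and> d dvd 2 ^ l - 1 \<and> 1 < d \<and> d < B + 1"
    unfolding A_def B_def sierpinski_cover_def triples_def by code_simp
  moreover have "\<forall>(l,r,d)\<in>triples riesel_cover. d dvd A \<and> d dvd B * 2 ^ r + -1 \<and> d dvd 2 ^ l - 1 \<and> 1 < d \<and> d < B + -1"
    unfolding A_def B_def riesel_cover_def triples_def by code_simp
  moreover have "A > 0" "even A" "B > 0" "odd B" by (auto simp: A_def B_def)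
  ultimately show ?thesis
    using composite_cover[OF sierpinski_cover, of A B 1 "A * int m + B" "int m"]
      composite_cover[OF riesel_cover, of A B "-1" "A * int m + B" "int m"]
    by (auto simp: brier_number_def sierpinski_number_def riesel_number_def intro: add_nonneg_pos)
qed

lemma coprime_progression:
  "coprime (7609973832199104332900520118697392466473343921195005927808542086911702037440072483::int)
     19613577555635811210751525911492599150619172808998516420233576073634048313995204010"
  by code_simp

theorem corollary3:
  fixes A B :: int
  defines "A \<equiv> 19613577555635811210751525911492599150619172808998516420233576073634048313995204010"
    and "B \<equiv> 7609973832199104332900520118697392466473343921195005927808542086911702037440072483"
  shows "infinite {p :: int. (\<exists>m :: nat. p = A * int m + B) \<and> prime p \<and> brier_number p}"
proof -
  have pos: "0 < A" "0 < B" "B < A" by (simp_all add: A_def B_def)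
  have "coprime B A" unfolding A_def B_def by (rule coprime_progression)
  hence "infinite {p. prime p \<and> [p = nat B] (mod nat A)}"
    using pos coprime_int_iff[of "nat B" "nat A"] by (intro infinite_primes_in_progression) auto
  hence "infinite (int ` {p. prime p \<and> [p = nat B] (mod nat A)})"
    by (subst finite_image_iff) (auto simp: inj_on_def)
  moreover have "int ` {p. prime p \<and> [p = nat B] (mod nat A)}
      \<subseteq> {p :: int. (\<exists>m :: nat. p = A * int m + B) \<and> prime p \<and> brier_number p}"
  proof
    fix x assume "x \<in> int ` {p. prime p \<and> [p = nat B] (mod nat A)}"
    then obtain p where p: "x = int p" "prime p" "[p = nat B] (mod nat A)" by auto
    \<comment> \<open>Since B < A, the residue of p is B itself, and the quotient serves as the
      nonnegative m.\<close>
    have "p mod nat A = nat B" using p(3) pos by (simp add: cong_def)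
    hence "p = nat A * (p div nat A) + nat B" using mult_div_mod_eq[of "nat A" p] by simp
    hence "int p = int (nat A * (p div nat A) + nat B)" by (rule arg_cong)
    hence "x = A * int (p div nat A) + B" using pos p(1) by simp
    moreover from this have "brier_number x"
      unfolding A_def B_def by (simp only: brier_progression)
    moreover have "prime x" using p(1,2) by simp
    ultimately show "x \<in> {p :: int. (\<exists>m :: nat. p = A * int m + B) \<and> prime p \<and> brier_number p}"
      by blast
  qed
  ultimately show ?thesis by (rule infinite_super[rotated])
qed

end
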